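(* Let $S^2\times S^3=\{(x_1,x_2,x_3,x_5,\dots,x_8):x_1^2+x_2^2+x_3^2=1=x_5^2+\dots+x_8^2\}$, with the $1$-form $\eta$ and the $2$-forms $\omega_1,\omega_2$ given (after restriction) by $$\eta=\tfrac13\sum_{j=1}^3x_j\beta_j,\qquad \omega_1=\tfrac{\sqrt3}{18}\sum_{j=1}^3\alpha_j\wedge\beta_j,\qquad \omega_2=\tfrac{2\sqrt3}{9}\,vol_{S^2}+\tfrac{\sqrt3}{9}\sum_{j=1}^3dx_j\wedge\beta_j .$$ (Together with $\omega_3=-\frac13d\eta+\frac29vol_{S^2}$ these form the hypo structure induced on $S^2\times S^3$ by the nearly Kähler structure of $S^3\times S^3$.) For each $\lambda<0$ and $\mu>\frac{\lambda}{3}$, the quadruplet $$\tilde\eta=\eta,\quad \tilde\omega_1=\sqrt{3\lambda(\lambda-3\mu)}\,\omega_1,\quad \tilde\omega_2=\sqrt{3\lambda(\lambda-3\mu)}\,\omega_2,\quad \tilde\omega_3=\lambda\,d\eta+\mu\,vol_{S^2}$$ defines a hypo structure on $S^2\times S^3$, which is double hypo if and only if $\lambda<-\frac14$ and $\mu=\frac{\lambda(4\lambda+2)}{3(4\lambda+1)}$. Moreover, this $SU(2)$-structure is Sasaki-Einstein only for $\lambda=-\frac12$ and $\mu=0$.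
   Context: On $S^2\times S^3$ put $\alpha_1=2x_3dx_2-2x_2dx_3$, $\alpha_2=-2x_3dx_1+2x_1dx_3$, $\alpha_3=2x_2dx_1-2x_1dx_2$; $\beta_1=2x_8dx_5+2x_7dx_6-2x_6dx_7-2x_5dx_8$, $\beta_2=-2x_7dx_5+2x_8dx_6+2x_5dx_7-2x_6dx_8$, $\beta_3=2x_6dx_5-2x_5dx_6+2x_8dx_7-2x_7dx_8$; and $vol_{S^2}=-x_3\,dx_1\wedge dx_2+x_2\,dx_1\wedge dx_3-x_1\,dx_2\wedge dx_3$. The $\beta_j$ are left-invariant forms on $S^3=SU(2)$ with $d\beta_1=-\beta_2\wedge\beta_3$, $d\beta_2=\beta_1\wedge\beta_3$, $d\beta_3=-\beta_1\wedge\beta_2$. An $SU(2)$-structure on a $5$-manifold is a quadruplet $(\eta,\omega_1,\omega_2,\omega_3)$ of a $1$-form $\eta$ and $2$-forms $\omega_i$ with $\omega_i\wedge\omega_j=\delta_{ij}v$ for some $4$-form $v$ with $v\wedge\eta$ nowhere zero, and such that $X\lrcorner\omega_1=Y\lrcorner\omega_2$ implies $\omega_3(X,Y)\ge 0$. Here it is called hypo (with $\omega_3$ as the closed form) if $d\omega_3=0$, $d(\eta\wedge\omega_1)=0$, $d(\eta\wedge\omega_2)=0$; nearly hypo if $d\omega_1=3\eta\wedge\omega_2$ and $d(\eta\wedge\omega_3)=-2\omega_1\wedge\omega_1$; double hypo if both; Sasaki-Einstein if $d\eta=-2\omega_3$, $d\omega_1=3\eta\wedge\omega_2$, $d\omega_2=-3\eta\wedge\omega_1$.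 *)

theory Defs
  imports "HOL-Analysis.Analysis" "HOL-Combinatorics.Permutations"
begin

section \<open>Differential forms on an embedded submanifold\<close>

text \<open>
  A form on a closed submanifold \<open>M\<close> of a Euclidean space \<open>'a\<close> is represented by a smooth form on
  \<open>'a\<close> whose restriction to \<open>M\<close> it is; every smooth form on \<open>M\<close> arises in this way. Two
  representatives stand for the same form on \<open>M\<close> iff they agree on vectors tangent to \<open>M\<close>, so all
  equations between forms are stated with \<open>eq_forms_on\<close>. Because wedge product and exterior
  derivative commute with pullback along the inclusion of \<open>M\<close>, both are taken on representatives.

  A \<open>k\<close>-form takes a point and a sequence of vectors, of which only those with index
  \<open>0, \<dots>, k - 1\<close> matter.
\<close>

type_synonym 'a form = "'a \<Rightarrow> (nat \<Rightarrow> 'a) \<Rightarrow> real"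

primrec Ck :: "nat \<Rightarrow> ('a::real_normed_vector \<Rightarrow> real) \<Rightarrow> bool" where
  "Ck 0 f \<longleftrightarrow> continuous_on UNIV f"
| "Ck (Suc k) f \<longleftrightarrow> f differentiable_on UNIV \<and> (\<forall>h. Ck k (\<lambda>x. frechet_derivative f (at x) h))"

definition alternating :: "nat \<Rightarrow> ((nat \<Rightarrow> 'a::real_vector) \<Rightarrow> real) \<Rightarrow> bool" where
  "alternating k f \<longleftrightarrow>
     (\<forall>v w. (\<forall>i<k. v i = w i) \<longrightarrow> f v = f w) \<and>
     (\<forall>v. \<forall>i<k. linear (\<lambda>a. f (v(i := a)))) \<and>
     (\<forall>v. \<forall>j<k. \<forall>i<j. v i = v j \<longrightarrow> f v = 0)"

definition smooth_form :: "nat \<Rightarrow> 'a::euclidean_space form \<Rightarrow> bool" where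
  "smooth_form k \<alpha> \<longleftrightarrow>
     (\<forall>p. alternating k (\<alpha> p)) \<and> (\<forall>v. \<forall>n. Ck n (\<lambda>p. \<alpha> p v))"

text \<open>
  Normalised so that \<open>(\<theta>\<^sub>1 \<and> \<theta>\<^sub>2)(X, Y) = \<theta>\<^sub>1(X) \<theta>\<^sub>2(Y) - \<theta>\<^sub>1(Y) \<theta>\<^sub>2(X)\<close> for \<open>1\<close>-forms.
\<close>

definition wedge :: "nat \<Rightarrow> nat \<Rightarrow> 'a form \<Rightarrow> 'a form \<Rightarrow> 'a form" where
  "wedge k l \<alpha> \<beta> = (\<lambda>p v.
     (\<Sum>\<sigma> | \<sigma> permutes {..<k + l}.
        of_int (sign \<sigma>) * \<alpha> p (\<lambda>i. v (\<sigma> i)) * \<beta> p (\<lambda>i. v (\<sigma> (k + i))))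
     / (fact k * fact l))"

definition ext_deriv :: "nat \<Rightarrow> 'a::euclidean_space form \<Rightarrow> 'a form" where
  "ext_deriv k \<alpha> = (\<lambda>p v.
     \<Sum>i\<le>k. (-1) ^ i *
       frechet_derivative (\<lambda>q. \<alpha> q (\<lambda>j. if j < i then v j else v (Suc j))) (at p) (v i))"

definition tangent_space :: "'a::euclidean_space set \<Rightarrow> 'a \<Rightarrow> 'a set" where
  "tangent_space M p =
     {u. \<exists>\<gamma>::real \<Rightarrow> 'a. (\<forall>t. \<gamma> t \<in> M) \<and> \<gamma> 0 = p \<and> (\<gamma> has_vector_derivative u) (at 0)}"

definition eq_forms_on :: "'a::euclidean_space set \<Rightarrow> nat \<Rightarrow> 'a form \<Rightarrow> 'a form \<Rightarrow> bool" where
  "eq_forms_on M k \<alpha> \<beta> \<longleftrightarrow>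
     (\<forall>p\<in>M. \<forall>v. (\<forall>i<k. v i \<in> tangent_space M p) \<longrightarrow> \<alpha> p v = \<beta> p v)"

definition nowhere_zero_on :: "'a::euclidean_space set \<Rightarrow> nat \<Rightarrow> 'a form \<Rightarrow> bool" where
  "nowhere_zero_on M k \<alpha> \<longleftrightarrow>
     (\<forall>p\<in>M. \<exists>v. (\<forall>i<k. v i \<in> tangent_space M p) \<and> \<alpha> p v \<noteq> 0)"

definition apply2 :: "'a form \<Rightarrow> 'a \<Rightarrow> 'a \<Rightarrow> 'a \<Rightarrow> real" where
  "apply2 \<omega> p X Y = \<omega> p (\<lambda>i. if i = 0 then X else Y)"

section \<open>SU(2)-structures on a 5-manifold\<close>

text \<open>The condition on \<open>Z\<close> below is the equality of \<open>1\<close>-forms \<open>X \<lrcorner> \<omega>\<^sub>1 = Y \<lrcorner> \<omega>\<^sub>2\<close> at \<open>p\<close>.\<close>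

definition su2_structure ::
  "'a::euclidean_space set \<Rightarrow> 'a form \<Rightarrow> 'a form \<Rightarrow> 'a form \<Rightarrow> 'a form \<Rightarrow> bool" where
  "su2_structure M \<eta> \<omega>\<^sub>1 \<omega>\<^sub>2 \<omega>\<^sub>3 \<longleftrightarrow>
     smooth_form 1 \<eta> \<and> smooth_form 2 \<omega>\<^sub>1 \<and> smooth_form 2 \<omega>\<^sub>2 \<and> smooth_form 2 \<omega>\<^sub>3 \<and>
     (\<exists>\<nu>. smooth_form 4 \<nu> \<and>
        (\<forall>i<3. \<forall>j<3. eq_forms_on M 4
           (wedge 2 2 ([\<omega>\<^sub>1, \<omega>\<^sub>2, \<omega>\<^sub>3] ! i) ([\<omega>\<^sub>1, \<omega>\<^sub>2, \<omega>\<^sub>3] ! j))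
           (\<lambda>p v. if i = j then \<nu> p v else 0)) \<and>
        nowhere_zero_on M 5 (wedge 4 1 \<nu> \<eta>)) \<and>
     (\<forall>p\<in>M. \<forall>X\<in>tangent_space M p. \<forall>Y\<in>tangent_space M p.
        (\<forall>Z\<in>tangent_space M p. apply2 \<omega>\<^sub>1 p X Z = apply2 \<omega>\<^sub>2 p Y Z) \<longrightarrow> apply2 \<omega>\<^sub>3 p X Y \<ge> 0)"

definition hypo ::
  "'a::euclidean_space set \<Rightarrow> 'a form \<Rightarrow> 'a form \<Rightarrow> 'a form \<Rightarrow> 'a form \<Rightarrow> bool" where
  "hypo M \<eta> \<omega>\<^sub>1 \<omega>\<^sub>2 \<omega>\<^sub>3 \<longleftrightarrow>
     su2_structure M \<eta> \<omega>\<^sub>1 \<omega>\<^sub>2 \<omega>\<^sub>3 \<and>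
     eq_forms_on M 3 (ext_deriv 2 \<omega>\<^sub>3) (\<lambda>p v. 0) \<and>
     eq_forms_on M 4 (ext_deriv 3 (wedge 1 2 \<eta> \<omega>\<^sub>1)) (\<lambda>p v. 0) \<and>
     eq_forms_on M 4 (ext_deriv 3 (wedge 1 2 \<eta> \<omega>\<^sub>2)) (\<lambda>p v. 0)"

definition nearly_hypo ::
  "'a::euclidean_space set \<Rightarrow> 'a form \<Rightarrow> 'a form \<Rightarrow> 'a form \<Rightarrow> 'a form \<Rightarrow> bool" where
  "nearly_hypo M \<eta> \<omega>\<^sub>1 \<omega>\<^sub>2 \<omega>\<^sub>3 \<longleftrightarrow>
     su2_structure M \<eta> \<omega>\<^sub>1 \<omega>\<^sub>2 \<omega>\<^sub>3 \<and>
     eq_forms_on M 3 (ext_deriv 2 \<omega>\<^sub>1) (\<lambda>p v. 3 * wedge 1 2 \<eta> \<omega>\<^sub>2 p v) \<and>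
     eq_forms_on M 4 (ext_deriv 3 (wedge 1 2 \<eta> \<omega>\<^sub>3)) (\<lambda>p v. - 2 * wedge 2 2 \<omega>\<^sub>1 \<omega>\<^sub>1 p v)"

definition double_hypo ::
  "'a::euclidean_space set \<Rightarrow> 'a form \<Rightarrow> 'a form \<Rightarrow> 'a form \<Rightarrow> 'a form \<Rightarrow> bool" where
  "double_hypo M \<eta> \<omega>\<^sub>1 \<omega>\<^sub>2 \<omega>\<^sub>3 \<longleftrightarrow> hypo M \<eta> \<omega>\<^sub>1 \<omega>\<^sub>2 \<omega>\<^sub>3 \<and> nearly_hypo M \<eta> \<omega>\<^sub>1 \<omega>\<^sub>2 \<omega>\<^sub>3"

definition sasaki_einstein ::
  "'a::euclidean_space set \<Rightarrow> 'a form \<Rightarrow> 'a form \<Rightarrow> 'a form \<Rightarrow> 'a form \<Rightarrow> bool" where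
  "sasaki_einstein M \<eta> \<omega>\<^sub>1 \<omega>\<^sub>2 \<omega>\<^sub>3 \<longleftrightarrow>
     su2_structure M \<eta> \<omega>\<^sub>1 \<omega>\<^sub>2 \<omega>\<^sub>3 \<and>
     eq_forms_on M 2 (ext_deriv 1 \<eta>) (\<lambda>p v. - 2 * \<omega>\<^sub>3 p v) \<and>
     eq_forms_on M 3 (ext_deriv 2 \<omega>\<^sub>1) (\<lambda>p v. 3 * wedge 1 2 \<eta> \<omega>\<^sub>2 p v) \<and>
     eq_forms_on M 3 (ext_deriv 2 \<omega>\<^sub>2) (\<lambda>p v. - 3 * wedge 1 2 \<eta> \<omega>\<^sub>1 p v)"

section \<open>The forms on the product of spheres\<close>

type_synonym ambient = "(real^3) \<times> (real^4)"

definition S2xS3 :: "ambient set" where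
  "S2xS3 = sphere 0 1 \<times> sphere 0 1"

lemma tangent_space_S2xS3:
  assumes "(a, b) \<in> S2xS3"
  shows "tangent_space S2xS3 (a, b) = {(u, w). a \<bullet> u = 0 \<and> b \<bullet> w = 0}"
proof
  show "tangent_space S2xS3 (a, b) \<subseteq> {(u, w). a \<bullet> u = 0 \<and> b \<bullet> w = 0}"
  proof
    fix z assume "z \<in> tangent_space S2xS3 (a, b)"
    then obtain \<gamma> where g: "\<And>t. \<gamma> t \<in> S2xS3" "\<gamma> 0 = (a, b)"
      and d: "(\<gamma> has_vector_derivative z) (at 0)"
      unfolding tangent_space_def by auto
    have "((\<lambda>t. fst (\<gamma> t)) has_derivative (\<lambda>t. fst (t *\<^sub>R z))) (at 0)"
      and "((\<lambda>t. snd (\<gamma> t)) has_derivative (\<lambda>t. snd (t *\<^sub>R z))) (at 0)"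
      using has_derivative_fst[OF d[unfolded has_vector_derivative_def]]
        has_derivative_snd[OF d[unfolded has_vector_derivative_def]] by simp_all
    from has_derivative_inner[OF this(1) this(1)] has_derivative_inner[OF this(2) this(2)]
    have "((\<lambda>t. fst (\<gamma> t) \<bullet> fst (\<gamma> t)) has_derivative (\<lambda>h. 2 * h * (a \<bullet> fst z))) (at 0)"
      and "((\<lambda>t. snd (\<gamma> t) \<bullet> snd (\<gamma> t)) has_derivative (\<lambda>h. 2 * h * (b \<bullet> snd z))) (at 0)"
      by (simp_all add: g(2) inner_commute algebra_simps)
    moreover have "(\<lambda>t. fst (\<gamma> t) \<bullet> fst (\<gamma> t)) = (\<lambda>t. 1)" "(\<lambda>t. snd (\<gamma> t) \<bullet> snd (\<gamma> t)) = (\<lambda>t. 1)"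
      using g(1) by (auto simp: S2xS3_def mem_Times_iff dot_square_norm)
    ultimately have "(\<lambda>h::real. 2 * h * (a \<bullet> fst z)) = (\<lambda>h. 0)" "(\<lambda>h::real. 2 * h * (b \<bullet> snd z)) = (\<lambda>h. 0)"
      by (metis has_derivative_const has_derivative_unique)+
    then have "2 * 1 * (a \<bullet> fst z) = 0" "2 * 1 * (b \<bullet> snd z) = 0"
      by meson+
    then show "z \<in> {(u, w). a \<bullet> u = 0 \<and> b \<bullet> w = 0}" by (cases z) auto
  qed
next
  have curve: "(\<forall>t. c t \<in> sphere 0 1) \<and> c 0 = q \<and> (c has_vector_derivative u) (at 0)"
    if q: "norm q = 1" "q \<bullet> u = 0" and c: "c = (\<lambda>t. inverse (sqrt (1 + t\<^sup>2 * (u \<bullet> u))) *\<^sub>R (q + t *\<^sub>R u))"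
    for c :: "real \<Rightarrow> 'c::euclidean_space" and q u
  proof (intro conjI allI)
    fix t
    have "(norm (q + t *\<^sub>R u))\<^sup>2 = 1 + t\<^sup>2 * (u \<bullet> u)"
      unfolding power2_norm_eq_inner using q
      by (simp add: inner_add inner_commute norm_eq_1 power2_eq_square)
    then have "norm (q + t *\<^sub>R u) = sqrt (1 + t\<^sup>2 * (u \<bullet> u))"
      by (metis norm_ge_zero real_sqrt_unique)
    moreover have "1 + t\<^sup>2 * (u \<bullet> u) > 0"
      by (intro add_pos_nonneg mult_nonneg_nonneg) auto
    ultimately show "c t \<in> sphere 0 1" by (simp add: c)
  next
    show "c 0 = q" by (simp add: c)
    have "((\<lambda>t. inverse (sqrt (1 + t\<^sup>2 * (u \<bullet> u)))) has_real_derivative 0) (at 0)"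
      by (auto intro!: derivative_eq_intros)
    moreover have "((\<lambda>t. q + t *\<^sub>R u) has_vector_derivative u) (at 0)"
      by (auto intro!: derivative_eq_intros)
    ultimately show "(c has_vector_derivative u) (at 0)"
      unfolding c by (auto intro!: has_vector_derivative_eq_rhs[OF has_vector_derivative_scaleR])
  qed
  show "{(u, w). a \<bullet> u = 0 \<and> b \<bullet> w = 0} \<subseteq> tangent_space S2xS3 (a, b)"
  proof clarify
    fix u w assume uw: "a \<bullet> u = 0" "b \<bullet> w = 0"
    have "norm a = 1" "norm b = 1" using assms by (auto simp: S2xS3_def)
    obtain c where "(\<forall>t. c t \<in> sphere 0 1) \<and> c 0 = a \<and> (c has_vector_derivative u) (at 0)"
      using curve[OF \<open>norm a = 1\<close> uw(1) refl] by (rule that)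
    moreover obtain d where "(\<forall>t. d t \<in> sphere 0 1) \<and> d 0 = b \<and> (d has_vector_derivative w) (at 0)"
      using curve[OF \<open>norm b = 1\<close> uw(2) refl] by (rule that)
    ultimately show "(u, w) \<in> tangent_space S2xS3 (a, b)"
      unfolding tangent_space_def S2xS3_def
      by (auto intro!: exI[of _ "\<lambda>t. (c t, d t)"] has_vector_derivative_Pair)
  qed
qed

text \<open>
  \<open>coord 1, coord 2, coord 3\<close> are the coordinates of the first factor and \<open>coord 5, \<dots>, coord 8\<close> those of the second;
  the index \<open>4\<close> is not used.
\<close>

definition coord :: "nat \<Rightarrow> ambient \<Rightarrow> real" where
  "coord k p = (if k \<le> 3 then fst p $ of_nat k else snd p $ of_nat (k - 4))"

definition dx :: "nat \<Rightarrow> ambient form" where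
  "dx k = (\<lambda>p v. coord k (v 0))"

definition alpha :: "nat \<Rightarrow> ambient form" where
  "alpha j = (\<lambda>p v.
     if j = 1 then 2 * coord 3 p * dx 2 p v - 2 * coord 2 p * dx 3 p v
     else if j = 2 then - 2 * coord 3 p * dx 1 p v + 2 * coord 1 p * dx 3 p v
     else 2 * coord 2 p * dx 1 p v - 2 * coord 1 p * dx 2 p v)"

definition beta :: "nat \<Rightarrow> ambient form" where
  "beta j = (\<lambda>p v.
     if j = 1 then
       2 * coord 8 p * dx 5 p v + 2 * coord 7 p * dx 6 p v - 2 * coord 6 p * dx 7 p v - 2 * coord 5 p * dx 8 p v
     else if j = 2 then
       - 2 * coord 7 p * dx 5 p v + 2 * coord 8 p * dx 6 p v + 2 * coord 5 p * dx 7 p v - 2 * coord 6 p * dx 8 p v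
     else
       2 * coord 6 p * dx 5 p v - 2 * coord 5 p * dx 6 p v + 2 * coord 8 p * dx 7 p v - 2 * coord 7 p * dx 8 p v)"

definition vol_S2 :: "ambient form" where
  "vol_S2 = (\<lambda>p v.
     - coord 3 p * wedge 1 1 (dx 1) (dx 2) p v
     + coord 2 p * wedge 1 1 (dx 1) (dx 3) p v
     - coord 1 p * wedge 1 1 (dx 2) (dx 3) p v)"

definition eta :: "ambient form" where
  "eta = (\<lambda>p v. 1 / 3 * (\<Sum>j = 1..3. coord j p * beta j p v))"

definition omega1 :: "ambient form" where
  "omega1 = (\<lambda>p v. sqrt 3 / 18 * (\<Sum>j = 1..3. wedge 1 1 (alpha j) (beta j) p v))"

definition omega2 :: "ambient form" where
  "omega2 = (\<lambda>p v.
     2 * sqrt 3 / 9 * vol_S2 p v + sqrt 3 / 9 * (\<Sum>j = 1..3. wedge 1 1 (dx j) (beta j) p v))"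

definition omega3 :: "ambient form" where
  "omega3 = (\<lambda>p v. - (1 / 3) * ext_deriv 1 eta p v + 2 / 9 * vol_S2 p v)"

definition omega1_tilde :: "real \<Rightarrow> real \<Rightarrow> ambient form" where
  "omega1_tilde lam mu = (\<lambda>p v. sqrt (3 * lam * (lam - 3 * mu)) * omega1 p v)"

definition omega2_tilde :: "real \<Rightarrow> real \<Rightarrow> ambient form" where
  "omega2_tilde lam mu = (\<lambda>p v. sqrt (3 * lam * (lam - 3 * mu)) * omega2 p v)"

definition omega3_tilde :: "real \<Rightarrow> real \<Rightarrow> ambient form" where
  "omega3_tilde lam mu = (\<lambda>p v. lam * ext_deriv 1 eta p v + mu * vol_S2 p v)"

end

theory Submission
  imports Defs
begin

text \<open>
  The group structure on the three-sphere makes the problem one of linear algebra at a point. Write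
  \<open>x\<close> for the point of the two-sphere, \<open>u\<close> for the part of a tangent vector along the two-sphere and
  \<open>b\<close> for the vector of its values under \<open>\<beta>\<^sub>1, \<beta>\<^sub>2, \<beta>\<^sub>3\<close>. All forms in question are expressions in inner
  and cross products of \<open>x\<close>, \<open>u\<close>, \<open>b\<close>, and so are their exterior derivatives, once the structure
  equations \<open>d\<beta> = - (b \<times> b) / 2\<close> (lemma \<open>beta_vec_tangent\<close>) are used. Hence, if \<open>x, f, g\<close> is an
  oriented orthonormal basis, everything has constant coefficients in the covectors
  \<open>P = f \<bullet> u\<close>, \<open>Q = g \<bullet> u\<close>, \<open>R = x \<bullet> b\<close>, \<open>S = f \<bullet> b\<close>, \<open>T = g \<bullet> b\<close>: up to scalar factors \<open>\<eta>\<close> is \<open>R\<close>, \<open>vol\<close> is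
  \<open>P Q\<close>, \<open>\<omega>\<^sub>1\<close> is \<open>P T - Q S\<close>, \<open>\<omega>\<^sub>2\<close> is \<open>- 2 P Q + P S + Q T\<close> and \<open>d\<eta>\<close> is \<open>P S + Q T - S T\<close>.

  In these terms \<open>d\<omega>\<^sub>1 = 3 \<eta> \<and> \<omega>\<^sub>2\<close> and \<open>d\<omega>\<^sub>2 = - 3 \<eta> \<and> \<omega>\<^sub>1\<close> hold identically and are unaffected by a
  common rescaling of \<open>\<omega>\<^sub>1, \<omega>\<^sub>2\<close>; moreover \<open>vol\<close> and \<open>d\<eta>\<close> are closed (lemma \<open>d_tilde_frame\<close>). All wedge
  products of two of the 2-forms are multiples of \<open>P Q S T\<close>, and those of \<open>\<omega>\<^sub>1, \<omega>\<^sub>2\<close> with each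
  other and with \<open>d\<eta>\<close> and \<open>vol\<close> vanish; the rescaling factor of the family equates the three squares (lemma
  \<open>wedge_tilde_frame\<close>). The positivity condition is a sum of squares with weights \<open>- \<lambda>/3\<close> and
  \<open>\<mu> - \<lambda>/3\<close> (lemma \<open>positivity_frame\<close>), both positive by the bounds on the parameters. The hypo
  equations follow by the Leibniz rule, as \<open>\<eta> \<and> \<eta> = 0\<close> and \<open>d\<eta> \<and> \<omega>\<^sub>1 = d\<eta> \<and> \<omega>\<^sub>2 = 0\<close>.

  The only condition in the double hypo case that involves the parameters is
  \<open>d(\<eta> \<and> \<omega>\<^sub>3) = - 2 \<omega>\<^sub>1 \<and> \<omega>\<^sub>1\<close>. Its left side is \<open>d\<eta> \<and> \<omega>\<^sub>3\<close>, and comparing coefficients of \<open>P Q S T\<close>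
  gives \<open>3\<mu>(4\<lambda> + 1) = \<lambda>(4\<lambda> + 2)\<close>. In the Sasaki-Einstein case the only such condition is
  \<open>d\<eta> = - 2 \<omega>\<^sub>3\<close>, which is \<open>(1 + 2\<lambda>) d\<eta> + 2\<mu> vol = 0\<close>. The structure without parameters is the member
  \<open>\<lambda> = - 1/3\<close>, \<open>\<mu> = 2/9\<close> of the family.
\<close>

section \<open>Alternating forms and wedge products\<close>

lemma alternating_cong:
  assumes "alternating k f" "\<And>i. i < k \<Longrightarrow> v i = w i"
  shows "f v = f w"
  using assms by (simp add: alternating_def)

lemma alternating_linear:
  assumes "alternating k f" "i < k"
  shows "linear (\<lambda>a. f (v(i := a)))"
  using assms by (simp add: alternating_def)

lemma alternating_repeat:
  assumes "alternating k f" "i < k" "j < k" "i \<noteq> j" "v i = v j"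
  shows "f v = 0"
proof -
  have *: "\<forall>v. \<forall>j<k. \<forall>i<j. v i = v j \<longrightarrow> f v = 0"
    using assms(1) by (simp add: alternating_def)
  from assms(4) consider "i < j" | "j < i" by linarith
  then show ?thesis using * assms by cases auto
qed

text \<open>
  Polarisation: \<open>f\<close> vanishes when the two slots hold the same vector, so expanding the sum
  of the two vectors placed in both slots leaves only the mixed terms.
\<close>

lemma alternating_transpose:
  assumes f: "alternating k f" and ij: "i < k" "j < k" "i \<noteq> j"
  shows "f (\<lambda>m. v (Transposition.transpose i j m)) = - f v"
proof -
  define F where "F a b = f (v(i := a, j := b))" for a b
  have "linear (\<lambda>b. F a b)" for a
    unfolding F_def using alternating_linear[OF f ij(2)] .
  moreover have "linear (\<lambda>a. F a b)" for b
    unfolding F_def using alternating_linear[OF f ij(1), of "v(j := b)"] ij(3)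
    by (simp add: fun_upd_twist)
  moreover have "F a a = 0" for a
    unfolding F_def by (rule alternating_repeat[OF f ij]) (use ij in auto)
  ultimately have "F (v i) (v j) + F (v j) (v i) = 0"
    by (metis (no_types, lifting) add.right_neutral add_0 linear_add)
  moreover have "v(i := v i, j := v j) = v" by auto
  moreover have "v(i := v j, j := v i) = (\<lambda>m. v (Transposition.transpose i j m))"
    by (auto simp: Transposition.transpose_def fun_eq_iff)
  ultimately show ?thesis by (simp add: F_def)
qed

lemma alternating_permute:
  assumes f: "alternating k f" and "\<sigma> permutes {..<k}"
  shows "f (\<lambda>m. v (\<sigma> m)) = of_int (sign \<sigma>) * f v"
  using finite_lessThan assms(2)
proof (induction rule: permutes_rev_induct)
  case id
  then show ?case by simp
next
  case (swap a b \<sigma>)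
  have "permutation \<sigma>" using swap.hyps permutation_permutes by blast
  then have "sign (\<sigma> \<circ> Transposition.transpose a b) = - sign \<sigma>"
    using swap by (simp add: sign_compose permutation_swap_id sign_swap_id)
  then have "sign (\<lambda>m. \<sigma> (Transposition.transpose a b m)) = - sign \<sigma>"
    by (simp add: comp_def)
  then show ?case
    using alternating_transpose[OF f, of a b "\<lambda>m. v (\<sigma> m)"] swap by simp
qed

lemma alternating_wedge:
  assumes a: "alternating k (\<alpha> p)" and b: "alternating l (\<beta> p)"
  shows "alternating (k + l) (wedge k l \<alpha> \<beta> p)"
proof -
  define F where "F v \<sigma> = of_int (sign \<sigma>) * \<alpha> p (\<lambda>i. v (\<sigma> i)) * \<beta> p (\<lambda>i. v (\<sigma> (k + i)))" for v \<sigma>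
  have W: "wedge k l \<alpha> \<beta> p = (\<lambda>v. (\<Sum>\<sigma> | \<sigma> permutes {..<k + l}. F v \<sigma>) / (fact k * fact l))"
    by (simp add: wedge_def F_def)
  have lt: "\<sigma> i < k + l" if "\<sigma> permutes {..<k + l}" "i < k + l" for \<sigma> i
    using permutes_in_image[OF that(1), of i] that(2) by simp
  have cong: "F v \<sigma> = F w \<sigma>" if "\<sigma> permutes {..<k + l}" "\<forall>i<k + l. v i = w i" for v w \<sigma>
  proof -
    have "\<alpha> p (\<lambda>i. v (\<sigma> i)) = \<alpha> p (\<lambda>i. w (\<sigma> i))"
      by (rule alternating_cong[OF a]) (use that lt in auto)
    moreover have "\<beta> p (\<lambda>i. v (\<sigma> (k + i))) = \<beta> p (\<lambda>i. w (\<sigma> (k + i)))"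
      by (rule alternating_cong[OF b]) (use that lt in auto)
    ultimately show ?thesis by (simp add: F_def)
  qed
  \<comment> \<open>Each slot of the product feeds exactly one of the two factors.\<close>
  have lin: "linear (\<lambda>x. F (v(i := x)) \<sigma>)" if s: "\<sigma> permutes {..<k + l}" and i: "i < k + l" for v i \<sigma>
  proof -
    obtain j where j: "j < k + l" "\<sigma> j = i"
      using permutes_image[OF s] i by (metis imageE lessThan_iff)
    have inj: "\<sigma> m = i \<longleftrightarrow> m = j" for m
      using permutes_inj[OF s] j by (metis injD)
    show ?thesis
    proof (cases "j < k")
      case True
      have 1: "(\<lambda>m. (v(i := x)) (\<sigma> m)) = (\<lambda>m. v (\<sigma> m))(j := x)" for x
        using inj by (auto simp: fun_eq_iff)
      have 2: "(\<lambda>m. (v(i := x)) (\<sigma> (k + m))) = (\<lambda>m. v (\<sigma> (k + m)))" for x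
        using inj True by (auto simp: fun_eq_iff)
      show ?thesis
        unfolding F_def 1 2
        using linear_compose_scale_right[OF alternating_linear[OF a True, of "\<lambda>m. v (\<sigma> m)"],
          of "of_int (sign \<sigma>) * \<beta> p (\<lambda>m. v (\<sigma> (k + m)))"]
        by (simp add: mult_ac)
    next
      case False
      have 1: "\<alpha> p (\<lambda>m. (v(i := x)) (\<sigma> m)) = \<alpha> p (\<lambda>m. v (\<sigma> m))" for x
        by (rule alternating_cong[OF a]) (use inj False in auto)
      have 2: "(\<lambda>m. (v(i := x)) (\<sigma> (k + m))) = (\<lambda>m. v (\<sigma> (k + m)))(j - k := x)" for x
        using inj False by (auto simp: fun_eq_iff)
      have "j - k < l" using False j by simp
      then show ?thesis
        unfolding F_def 1 2
        using linear_compose_scale_right[OF alternating_linear[OF b, of "j - k" "\<lambda>m. v (\<sigma> (k + m))"],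
          of "of_int (sign \<sigma>) * \<alpha> p (\<lambda>m. v (\<sigma> m))"]
        by (simp add: mult_ac)
    qed
  qed
  \<comment> \<open>If two arguments agree, composing with their transposition pairs off the summands with
    opposite signs.\<close>
  have zero: "(\<Sum>\<sigma> | \<sigma> permutes {..<k + l}. F v \<sigma>) = 0"
    if ij: "i < k + l" "j < k + l" "i \<noteq> j" "v i = v j" for v i j
  proof -
    have t: "Transposition.transpose i j permutes {..<k + l}"
      using ij by (simp add: permutes_swap_id)
    have v: "v (Transposition.transpose i j m) = v m" for m
      using ij by (simp add: Transposition.transpose_def)
    have "F v (Transposition.transpose i j \<circ> \<sigma>) = - F v \<sigma>" if "\<sigma> permutes {..<k + l}" for \<sigma>
    proof -
      have "permutation \<sigma>" using that permutation_permutes by blast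
      then have "sign (Transposition.transpose i j \<circ> \<sigma>) = - sign \<sigma>"
        using ij by (simp add: sign_compose permutation_swap_id sign_swap_id)
      then show ?thesis by (simp add: F_def v)
    qed
    then have "(\<Sum>\<sigma> | \<sigma> permutes {..<k + l}. F v \<sigma>) = (\<Sum>\<sigma> | \<sigma> permutes {..<k + l}. - F v \<sigma>)"
      by (subst setum_permutations_compose_left[OF t]) simp
    then show ?thesis by (simp add: sum_negf)
  qed
  show ?thesis
    unfolding alternating_def W
  proof (intro conjI allI impI)
    fix v w :: "nat \<Rightarrow> 'a" assume "\<forall>i<k + l. v i = w i"
    then show "(\<Sum>\<sigma> | \<sigma> permutes {..<k + l}. F v \<sigma>) / (fact k * fact l) =
        (\<Sum>\<sigma> | \<sigma> permutes {..<k + l}. F w \<sigma>) / (fact k * fact l)"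
      by (metis (mono_tags, lifting) cong mem_Collect_eq sum.cong)
  next
    fix v i assume "i < k + l"
    then have "linear (\<lambda>x. \<Sum>\<sigma> | \<sigma> permutes {..<k + l}. F (v(i := x)) \<sigma>)"
      by (intro linear_compose_sum) (auto intro: lin)
    from linear_compose_scale_right[OF this, of "1 / (fact k * fact l)"]
    show "linear (\<lambda>x. (\<Sum>\<sigma> | \<sigma> permutes {..<k + l}. F (v(i := x)) \<sigma>) / (fact k * fact l))"
      by simp
  next
    fix v :: "nat \<Rightarrow> 'a" and j i assume "j < k + l" "i < j" "v i = v j"
    then show "(\<Sum>\<sigma> | \<sigma> permutes {..<k + l}. F v \<sigma>) / (fact k * fact l) = 0"
      using zero[of i j v] by simp
  qed
qed

lemma form_eq_apply2: "alternating 2 (\<omega> p) \<Longrightarrow> \<omega> p v = apply2 \<omega> p (v 0) (v 1)"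
  unfolding apply2_def by (rule alternating_cong) (auto simp: less_2_cases_iff)

lemma apply2_swap: "alternating 2 (\<omega> p) \<Longrightarrow> apply2 \<omega> p X Y = - apply2 \<omega> p Y X"
  unfolding apply2_def
  by (subst alternating_transpose[symmetric, of 2 "\<omega> p" 0 1])
    (auto simp: Transposition.transpose_def intro!: alternating_cong[of 2 "\<omega> p"])

text \<open>
  For forms of low degree the sum over all permutations collapses to a sum over shuffles, since
  permutations inside a block cancel the factorials in the normalisation.
\<close>

lemma wedge_1_1:
  assumes "alternating 1 (\<alpha> p)" "alternating 1 (\<beta> p)"
  shows "wedge 1 1 \<alpha> \<beta> p v =
    \<alpha> p (\<lambda>_. v 0) * \<beta> p (\<lambda>_. v 1) - \<alpha> p (\<lambda>_. v 1) * \<beta> p (\<lambda>_. v 0)"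
proof -
  have A: "\<alpha> p w = \<alpha> p (\<lambda>_. w 0)" and B: "\<beta> p w = \<beta> p (\<lambda>_. w 0)" for w
    by (rule alternating_cong[OF assms(1)] alternating_cong[OF assms(2)], simp)+
  have W: "wedge 1 1 \<alpha> \<beta> p v = (\<Sum>\<sigma> | \<sigma> permutes {..<1 + 1}.
      of_int (sign \<sigma>) * \<alpha> p (\<lambda>_. v (\<sigma> 0)) * \<beta> p (\<lambda>_. v (\<sigma> 1)))"
    unfolding wedge_def by (subst A, subst B) simp
  have S: "{..<1 + 1} = insert 1 {0::nat}" by auto
  have p: "finite {0::nat}" "(1::nat) \<notin> {0}" by auto
  show ?thesis
    unfolding W S sum_over_permutations_insert[OF p] permutes_sing
    by (simp add: sign_swap_id)
qed

lemma wedge_1_2: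
  assumes a: "alternating 1 (\<alpha> p)" and b: "alternating 2 (\<beta> p)"
  shows "wedge 1 2 \<alpha> \<beta> p v = \<alpha> p (\<lambda>_. v 0) * apply2 \<beta> p (v 1) (v 2)
    - \<alpha> p (\<lambda>_. v 1) * apply2 \<beta> p (v 0) (v 2) + \<alpha> p (\<lambda>_. v 2) * apply2 \<beta> p (v 0) (v 1)"
proof -
  have A: "\<alpha> p w = \<alpha> p (\<lambda>_. w 0)" for w
    by (rule alternating_cong[OF a]) simp
  define B where "B i j = apply2 \<beta> p (v i) (v j)" for i j
  have W: "wedge 1 2 \<alpha> \<beta> p v = (\<Sum>\<sigma> | \<sigma> permutes {..<3}.
      of_int (sign \<sigma>) * \<alpha> p (\<lambda>_. v (\<sigma> 0)) * B (\<sigma> 1) (\<sigma> 2)) / 2"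
    unfolding wedge_def B_def
    by (subst A, subst form_eq_apply2[of \<beta> p, OF b]) (simp add: numeral_2_eq_2 numeral_3_eq_3)
  have S: "{..<3} = insert 2 (insert 1 {0::nat})" by auto
  have p: "finite {0::nat}" "(1::nat) \<notin> {0}" "finite {1,0::nat}" "(2::nat) \<notin> {1,0}" by auto
  have s: "B 1 0 = - B 0 1" "B 2 0 = - B 0 2" "B 2 1 = - B 1 2"
    unfolding B_def by (rule apply2_swap[of \<beta> p, OF b])+
  show ?thesis
    unfolding W S sum_over_permutations_insert[OF p(3,4)] sum_over_permutations_insert[OF p(1,2)]
      permutes_sing
    by (simp add: sign_swap_id sign_compose permutation_swap_id permutation_compose Transposition.transpose_def
      s[unfolded One_nat_def] B_def[symmetric])
qed

lemma wedge_2_2: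
  assumes a: "alternating 2 (\<alpha> p)" and b: "alternating 2 (\<beta> p)"
  shows "wedge 2 2 \<alpha> \<beta> p v =
      apply2 \<alpha> p (v 0) (v 1) * apply2 \<beta> p (v 2) (v 3) - apply2 \<alpha> p (v 0) (v 2) * apply2 \<beta> p (v 1) (v 3)
    + apply2 \<alpha> p (v 0) (v 3) * apply2 \<beta> p (v 1) (v 2) + apply2 \<alpha> p (v 1) (v 2) * apply2 \<beta> p (v 0) (v 3)
    - apply2 \<alpha> p (v 1) (v 3) * apply2 \<beta> p (v 0) (v 2) + apply2 \<alpha> p (v 2) (v 3) * apply2 \<beta> p (v 0) (v 1)"
proof -
  define A where "A i j = apply2 \<alpha> p (v i) (v j)" for i j
  define B where "B i j = apply2 \<beta> p (v i) (v j)" for i j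
  have W: "wedge 2 2 \<alpha> \<beta> p v = (\<Sum>\<sigma> | \<sigma> permutes {..<4}.
      of_int (sign \<sigma>) * A (\<sigma> 0) (\<sigma> 1) * B (\<sigma> 2) (\<sigma> 3)) / 4"
    unfolding wedge_def B_def A_def
    by (subst form_eq_apply2[of \<alpha> p, OF a], subst form_eq_apply2[of \<beta> p, OF b])
      (simp add: fact_2 numeral_3_eq_3[symmetric])
  have S: "{..<4} = insert 3 (insert 2 (insert 1 {0::nat}))" by auto
  have p: "finite {0::nat}" "(1::nat) \<notin> {0}" "finite {1,0::nat}" "(2::nat) \<notin> {1,0}"
    "finite {2,1,0::nat}" "(3::nat) \<notin> {2,1,0}" by auto
  have s: "A 1 0 = - A 0 1" "A 2 0 = - A 0 2" "A 2 1 = - A 1 2"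
    "A 3 0 = - A 0 3" "A 3 1 = - A 1 3" "A 3 2 = - A 2 3"
    unfolding A_def by (rule apply2_swap[of \<alpha> p, OF a])+
  have t: "B 1 0 = - B 0 1" "B 2 0 = - B 0 2" "B 2 1 = - B 1 2"
    "B 3 0 = - B 0 3" "B 3 1 = - B 1 3" "B 3 2 = - B 2 3"
    unfolding B_def by (rule apply2_swap[of \<beta> p, OF b])+
  show ?thesis
    unfolding W S sum_over_permutations_insert[OF p(5,6)] sum_over_permutations_insert[OF p(3,4)]
      sum_over_permutations_insert[OF p(1,2)] permutes_sing
    by (simp add: sign_swap_id sign_compose permutation_swap_id permutation_compose Transposition.transpose_def
      s[unfolded One_nat_def] t[unfolded One_nat_def]
      A_def[symmetric] B_def[symmetric])
qed

text \<open>
  This evaluates a top-degree form on a basis adapted to the covector \<open>\<beta>\<close>: only permutations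
  fixing the last index contribute, and each of these contributes the same amount.
\<close>

lemma wedge_1_right_last:
  assumes a: "alternating k (\<alpha> p)" and b: "alternating 1 (\<beta> p)"
    and z: "\<And>i. i < k \<Longrightarrow> \<beta> p (\<lambda>_. v i) = 0"
  shows "wedge k 1 \<alpha> \<beta> p v = \<alpha> p v * \<beta> p (\<lambda>_. v k)"
proof -
  define F where "F \<sigma> = of_int (sign \<sigma>) * \<alpha> p (\<lambda>i. v (\<sigma> i)) * \<beta> p (\<lambda>i. v (\<sigma> (k + i)))" for \<sigma>
  have B: "\<beta> p w = \<beta> p (\<lambda>_. w 0)" for w
    by (rule alternating_cong[OF b]) simp
  have "F \<sigma> = 0" if "\<sigma> permutes {..<k + 1}" "\<not> \<sigma> permutes {..<k}" for \<sigma>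
  proof -
    have "\<sigma> k \<noteq> k"
    proof
      assume "\<sigma> k = k"
      then have "\<sigma> permutes {..<k}"
        by (intro permutes_superset[OF that(1)]) (auto simp: less_Suc_eq)
      then show False using that(2) by simp
    qed
    moreover have "\<sigma> k < k + 1" using permutes_in_image[OF that(1), of k] by simp
    ultimately have "\<sigma> k < k" by simp
    then show ?thesis unfolding F_def by (subst B) (simp add: z)
  qed
  moreover have "F \<sigma> = \<alpha> p v * \<beta> p (\<lambda>_. v k)" if "\<sigma> permutes {..<k}" for \<sigma>
  proof -
    have "\<sigma> k = k" using that by (simp add: permutes_not_in)
    moreover have "of_int (sign \<sigma>) * of_int (sign \<sigma>) = (1::real)"
      by (metis of_int_1 of_int_mult sign_idempotent)
    ultimately show ?thesis
      unfolding F_def by (subst B) (simp add: alternating_permute[OF a that])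
  qed
  moreover have "{\<sigma>. \<sigma> permutes {..<k}} \<subseteq> {\<sigma>. \<sigma> permutes {..<k + 1}}"
    by (auto elim: permutes_subset)
  ultimately have "(\<Sum>\<sigma> | \<sigma> permutes {..<k + 1}. F \<sigma>) =
      (\<Sum>\<sigma> | \<sigma> permutes {..<k}. \<alpha> p v * \<beta> p (\<lambda>_. v k))"
    by (intro sum.mono_neutral_cong_right) (auto simp: finite_permutations)
  then show ?thesis
    by (simp add: wedge_def F_def card_permutations[of _ k])
qed

section \<open>Smooth forms and the exterior derivative\<close>

lemma Ck_imp_differentiable: "Ck (Suc n) f \<Longrightarrow> f differentiable (at x)"
  by (simp add: differentiable_on_def)

lemma Ck_SucD: "Ck (Suc n) f \<Longrightarrow> Ck n f"
proof (induction n arbitrary: f)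
  case 0
  then show ?case by (simp add: differentiable_imp_continuous_on)
next
  case (Suc n)
  have "Ck n (\<lambda>x. frechet_derivative f (at x) h)" for h
    using Suc.prems Suc.IH by (metis Ck.simps(2))
  then show ?case using Suc.prems by simp
qed

lemma Ck_const: "Ck n (\<lambda>x. c)"
  by (induction n arbitrary: c) (simp_all add: frechet_derivative_const)

lemma Ck_bounded_linear: "bounded_linear f \<Longrightarrow> Ck n f"
proof (cases n)
  case 0
  then show "bounded_linear f \<Longrightarrow> ?thesis"
    by (simp add: linear_continuous_on)
next
  case (Suc m)
  assume f: "bounded_linear f"
  then have "frechet_derivative f (at x) = f" for x
    by (metis bounded_linear_imp_has_derivative frechet_derivative_at)
  moreover have "f differentiable_on UNIV"
    using f by (simp add: bounded_linear_imp_differentiable_on)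
  ultimately show ?thesis by (simp add: Suc Ck_const)
qed

lemma Ck_add: "Ck n f \<Longrightarrow> Ck n g \<Longrightarrow> Ck n (\<lambda>x. f x + g x)"
proof (induction n arbitrary: f g)
  case 0
  then show ?case by (simp add: continuous_on_add)
next
  case (Suc n)
  have d: "f differentiable (at x)" "g differentiable (at x)" for x
    using Suc.prems Ck_imp_differentiable by blast+
  have "frechet_derivative (\<lambda>x. f x + g x) (at x) =
      (\<lambda>h. frechet_derivative f (at x) h + frechet_derivative g (at x) h)" for x
    using has_derivative_add[OF d[of x, unfolded frechet_derivative_works]]
    by (rule frechet_derivative_at[symmetric])
  then show ?case
    using Suc d by (auto simp: differentiable_on_def)
qed

lemma Ck_mult: "Ck n f \<Longrightarrow> Ck n g \<Longrightarrow> Ck n (\<lambda>x. f x * g x)"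
proof (induction n arbitrary: f g)
  case 0
  then show ?case by (simp add: continuous_on_mult)
next
  case (Suc n)
  have d: "f differentiable (at x)" "g differentiable (at x)" for x
    using Suc.prems Ck_imp_differentiable by blast+
  have "frechet_derivative (\<lambda>x. f x * g x) (at x) =
      (\<lambda>h. f x * frechet_derivative g (at x) h + frechet_derivative f (at x) h * g x)" for x
    using has_derivative_mult[OF d[of x, unfolded frechet_derivative_works]]
    by (rule frechet_derivative_at[symmetric])
  moreover have "Ck n f" "Ck n g" using Suc.prems Ck_SucD by blast+
  ultimately show ?case
    using Suc d by (auto simp: differentiable_on_def intro!: Ck_add)
qed

lemma Ck_cmult: "Ck n f \<Longrightarrow> Ck n (\<lambda>x. c * f x)"
  using Ck_mult[OF Ck_const] .

lemma Ck_minus: "Ck n f \<Longrightarrow> Ck n g \<Longrightarrow> Ck n (\<lambda>x. f x - g x)"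
  using Ck_add[of n f "\<lambda>x. -1 * g x"] Ck_cmult[of n g "-1"] by simp

lemma Ck_sum: "(\<And>i. i \<in> I \<Longrightarrow> Ck n (f i)) \<Longrightarrow> Ck n (\<lambda>x. \<Sum>i\<in>I. f i x)"
  by (induction I rule: infinite_finite_induct) (simp_all add: Ck_const Ck_add)

lemma smooth_form_alternating: "smooth_form k \<alpha> \<Longrightarrow> alternating k (\<alpha> p)"
  by (simp add: smooth_form_def)

lemma smooth_form_differentiable: "smooth_form k \<alpha> \<Longrightarrow> (\<lambda>q. \<alpha> q v) differentiable (at p)"
  unfolding smooth_form_def using Ck_imp_differentiable by blast

lemma smooth_form_has_derivative:
  "smooth_form k \<alpha> \<Longrightarrow> ((\<lambda>q. \<alpha> q v) has_derivative frechet_derivative (\<lambda>q. \<alpha> q v) (at p)) (at p)"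
  using smooth_form_differentiable frechet_derivative_works by blast

lemma smooth_form_mult:
  assumes f: "\<And>n. Ck n f" and a: "smooth_form k \<alpha>"
  shows "smooth_form k (\<lambda>p v. f p * \<alpha> p v)"
proof -
  have lin: "linear F \<Longrightarrow> linear (\<lambda>x. c * F x)" for c and F :: "'a \<Rightarrow> real"
    using linear_compose_scale_right[of F c] by simp
  have "alternating k (\<lambda>v. f p * \<alpha> p v)" for p
    using smooth_form_alternating[OF a, of p] by (auto simp: alternating_def intro: lin)
  then show ?thesis
    using a f by (simp add: smooth_form_def Ck_mult)
qed

lemma smooth_form_scale: "smooth_form k \<alpha> \<Longrightarrow> smooth_form k (\<lambda>p v. c * \<alpha> p v)"
  by (rule smooth_form_mult) (rule Ck_const)

lemma smooth_form_add:
  assumes "smooth_form k \<alpha>" "smooth_form k \<beta>"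
  shows "smooth_form k (\<lambda>p v. \<alpha> p v + \<beta> p v)"
proof -
  have "alternating k (\<lambda>v. \<alpha> p v + \<beta> p v)" for p
  proof -
    have "alternating k (\<alpha> p)" "alternating k (\<beta> p)"
      using assms by (auto intro: smooth_form_alternating)
    then show ?thesis
      by (auto simp: alternating_def intro!: linear_compose_add arg_cong2[where f = "(+)"])
  qed
  then show ?thesis
    using assms by (simp add: smooth_form_def Ck_add)
qed

lemma smooth_form_diff:
  "smooth_form k \<alpha> \<Longrightarrow> smooth_form k \<beta> \<Longrightarrow> smooth_form k (\<lambda>p v. \<alpha> p v - \<beta> p v)"
  using smooth_form_add[of k \<alpha> "\<lambda>p v. -1 * \<beta> p v"] smooth_form_scale[of k \<beta> "-1"] by simp

lemma smooth_form_sum: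
  assumes "finite I" "I \<noteq> {}" "\<And>i. i \<in> I \<Longrightarrow> smooth_form k (\<alpha> i)"
  shows "smooth_form k (\<lambda>p v. \<Sum>i\<in>I. \<alpha> i p v)"
  using assms by (induction rule: finite_ne_induct) (simp_all add: smooth_form_add)

lemma smooth_form_wedge:
  assumes "smooth_form k \<alpha>" "smooth_form l \<beta>"
  shows "smooth_form (k + l) (wedge k l \<alpha> \<beta>)"
proof -
  have "Ck n (\<lambda>p. wedge k l \<alpha> \<beta> p v)" for n v
  proof -
    have "Ck n (\<lambda>p. (\<Sum>\<sigma> | \<sigma> permutes {..<k + l}. of_int (sign \<sigma>) * \<alpha> p (\<lambda>i. v (\<sigma> i)) *
        \<beta> p (\<lambda>i. v (\<sigma> (k + i)))) * (1 / (fact k * fact l)))"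
      using assms by (intro Ck_mult Ck_sum Ck_const) (auto simp: smooth_form_def)
    then show ?thesis by (simp add: wedge_def)
  qed
  then show ?thesis
    using assms by (simp add: smooth_form_def alternating_wedge)
qed

lemma ext_deriv_1:
  assumes "smooth_form 1 \<alpha>"
  shows "ext_deriv 1 \<alpha> p v = frechet_derivative (\<lambda>q. \<alpha> q (\<lambda>_. v 1)) (at p) (v 0)
    - frechet_derivative (\<lambda>q. \<alpha> q (\<lambda>_. v 0)) (at p) (v 1)"
proof -
  have A: "\<alpha> q w = \<alpha> q (\<lambda>_. w 0)" for q w
    by (rule alternating_cong[OF smooth_form_alternating[OF assms]]) simp
  show ?thesis
    unfolding ext_deriv_def by (subst A) simp
qed

lemma ext_deriv_2:
  assumes "smooth_form 2 \<omega>"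
  shows "ext_deriv 2 \<omega> p v =
      frechet_derivative (\<lambda>q. apply2 \<omega> q (v 1) (v 2)) (at p) (v 0)
    - frechet_derivative (\<lambda>q. apply2 \<omega> q (v 0) (v 2)) (at p) (v 1)
    + frechet_derivative (\<lambda>q. apply2 \<omega> q (v 0) (v 1)) (at p) (v 2)"
proof -
  have A: "\<omega> q w = apply2 \<omega> q (w 0) (w 1)" for q w
    by (rule form_eq_apply2[of \<omega> q, OF smooth_form_alternating[OF assms]])
  show ?thesis
    unfolding ext_deriv_def by (subst A) (simp add: numeral_2_eq_2)
qed

lemma ext_deriv_scale:
  assumes "smooth_form k \<alpha>"
  shows "ext_deriv k (\<lambda>p v. c * \<alpha> p v) = (\<lambda>p v. c * ext_deriv k \<alpha> p v)"
proof -
  have "frechet_derivative (\<lambda>q. c * \<alpha> q v) (at p) = (\<lambda>h. c * frechet_derivative (\<lambda>q. \<alpha> q v) (at p) h)"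
    for p v
    using has_derivative_mult_right[OF smooth_form_has_derivative[OF assms]]
    by (rule frechet_derivative_at[symmetric])
  then show ?thesis
    by (simp add: ext_deriv_def fun_eq_iff sum_distrib_left mult_ac)
qed

lemma ext_deriv_add:
  assumes "smooth_form k \<alpha>" "smooth_form k \<beta>"
  shows "ext_deriv k (\<lambda>p v. \<alpha> p v + \<beta> p v) = (\<lambda>p v. ext_deriv k \<alpha> p v + ext_deriv k \<beta> p v)"
proof -
  have "frechet_derivative (\<lambda>q. \<alpha> q v + \<beta> q v) (at p) =
      (\<lambda>h. frechet_derivative (\<lambda>q. \<alpha> q v) (at p) h + frechet_derivative (\<lambda>q. \<beta> q v) (at p) h)" for p v
    using has_derivative_add[OF smooth_form_has_derivative[OF assms(1)] smooth_form_has_derivative[OF assms(2)]]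
    by (rule frechet_derivative_at[symmetric])
  then show ?thesis
    by (simp add: ext_deriv_def fun_eq_iff sum.distrib distrib_left)
qed

text \<open>
  Linearity of \<open>d\<alpha>\<close> in a slot combines linearity of the derivative in its direction with linearity
  of the derivative in the differentiated function.
\<close>

lemma smooth_form_ext_deriv_1:
  assumes "smooth_form 1 \<alpha>"
  shows "smooth_form 2 (ext_deriv 1 \<alpha>)"
proof -
  define D where "D p X Y = frechet_derivative (\<lambda>q. \<alpha> q (\<lambda>_. Y)) (at p) X" for p X Y
  have E: "ext_deriv 1 \<alpha> p v = D p (v 0) (v 1) - D p (v 1) (v 0)" for p v
    unfolding D_def by (rule ext_deriv_1[OF assms])
  have l1: "linear (\<lambda>X. D p X Y)" for p Y
    unfolding D_def
    using smooth_form_differentiable[OF assms] linear_frechet_derivative by blast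
  have lin: "linear (\<lambda>Y. \<alpha> p (\<lambda>_. Y))" for p
  proof -
    have "\<alpha> p (\<lambda>_. Y) = \<alpha> p ((\<lambda>_. 0)(0 := Y))" for Y
      by (rule alternating_cong[OF smooth_form_alternating[OF assms]]) simp
    then show ?thesis
      using alternating_linear[OF smooth_form_alternating[OF assms], of 0 p "\<lambda>_. 0"] by simp
  qed
  have l: "\<alpha> p (\<lambda>_. X + Y) = \<alpha> p (\<lambda>_. X) + \<alpha> p (\<lambda>_. Y)" "\<alpha> p (\<lambda>_. c *\<^sub>R X) = c * \<alpha> p (\<lambda>_. X)"
    for p X Y c
    using linear_add[OF lin] linear_scale[OF lin] by simp_all
  note hd = smooth_form_has_derivative[OF assms]
  have l2: "linear (\<lambda>Y. D p X Y)" for p X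
  proof (rule linearI)
    fix Y Z
    show "D p X (Y + Z) = D p X Y + D p X Z"
      unfolding D_def l by (simp add: frechet_derivative_at[OF has_derivative_add[OF hd hd], symmetric])
  next
    fix c Y
    show "D p X (c *\<^sub>R Y) = c *\<^sub>R D p X Y"
      unfolding D_def l by (simp add: frechet_derivative_at[OF has_derivative_mult_right[OF hd], symmetric])
  qed
  have "alternating 2 (ext_deriv 1 \<alpha> p)" for p
    unfolding alternating_def E
    by (auto simp: less_2_cases_iff fun_upd_def intro!: linear_compose_sub l1 l2)
  moreover have "Ck n (\<lambda>p. D p X Y)" for n X Y
  proof -
    have "Ck (Suc n) (\<lambda>q. \<alpha> q (\<lambda>_. Y))"
      using assms by (simp add: smooth_form_def del: Ck.simps)
    then show ?thesis unfolding D_def by simp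
  qed
  ultimately show ?thesis
    unfolding smooth_form_def E by (simp add: Ck_minus)
qed

lemma wedge_scale:
  "wedge k l (\<lambda>p v. c * \<alpha> p v) \<beta> = (\<lambda>p v. c * wedge k l \<alpha> \<beta> p v)"
  "wedge k l \<alpha> (\<lambda>p v. c * \<beta> p v) = (\<lambda>p v. c * wedge k l \<alpha> \<beta> p v)"
  by (simp_all add: wedge_def fun_eq_iff sum_distrib_left mult_ac)

lemma wedge_add:
  "wedge k l (\<lambda>p v. \<alpha> p v + \<alpha>' p v) \<beta> = (\<lambda>p v. wedge k l \<alpha> \<beta> p v + wedge k l \<alpha>' \<beta> p v)"
  "wedge k l \<alpha> (\<lambda>p v. \<beta> p v + \<beta>' p v) = (\<lambda>p v. wedge k l \<alpha> \<beta> p v + wedge k l \<alpha> \<beta>' p v)"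
  by (simp_all add: wedge_def fun_eq_iff sum.distrib add_divide_distrib algebra_simps)

text \<open>
  The graded Leibniz rule \<open>d(\<alpha> \<and> \<omega>) = d\<alpha> \<and> \<omega> - \<alpha> \<and> d\<omega>\<close>. The last product is expanded along
  \<open>\<alpha>\<close>, which is the shape in which it is evaluated below when \<open>d\<omega>\<close> is a multiple of \<open>\<alpha> \<and> \<psi>\<close>.
\<close>

lemma ext_deriv_wedge_1_2:
  assumes a: "smooth_form 1 \<alpha>" and w: "smooth_form 2 \<omega>"
  shows "ext_deriv 3 (wedge 1 2 \<alpha> \<omega>) p v = wedge 2 2 (ext_deriv 1 \<alpha>) \<omega> p v
    - (\<Sum>i\<le>3. (-1) ^ i * \<alpha> p (\<lambda>_. v i) * ext_deriv 2 \<omega> p (\<lambda>j. if j < i then v j else v (Suc j)))"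
proof -
  define A where "A i = \<alpha> p (\<lambda>_. v i)" for i
  define W where "W i j = apply2 \<omega> p (v i) (v j)" for i j
  define DA where "DA i k = frechet_derivative (\<lambda>q. \<alpha> q (\<lambda>_. v i)) (at p) (v k)" for i k
  define DW where "DW i j k = frechet_derivative (\<lambda>q. apply2 \<omega> q (v i) (v j)) (at p) (v k)" for i j k
  have ha: "((\<lambda>q. \<alpha> q (\<lambda>_. X)) has_derivative frechet_derivative (\<lambda>q. \<alpha> q (\<lambda>_. X)) (at p)) (at p)" for X
    by (rule smooth_form_has_derivative[OF a])
  have hw: "((\<lambda>q. apply2 \<omega> q X Y) has_derivative frechet_derivative (\<lambda>q. apply2 \<omega> q X Y) (at p)) (at p)" for X Y
    unfolding apply2_def by (rule smooth_form_has_derivative[OF w])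
  have D: "frechet_derivative (\<lambda>q. wedge 1 2 \<alpha> \<omega> q (\<lambda>m. v (s m))) (at p) (v k) =
      A (s 0) * DW (s 1) (s 2) k + DA (s 0) k * W (s 1) (s 2)
    - (A (s 1) * DW (s 0) (s 2) k + DA (s 1) k * W (s 0) (s 2))
    + (A (s 2) * DW (s 0) (s 1) k + DA (s 2) k * W (s 0) (s 1))" for s k
  proof -
    have "wedge 1 2 \<alpha> \<omega> q (\<lambda>m. v (s m)) =
        \<alpha> q (\<lambda>_. v (s 0)) * apply2 \<omega> q (v (s 1)) (v (s 2))
      - \<alpha> q (\<lambda>_. v (s 1)) * apply2 \<omega> q (v (s 0)) (v (s 2))
      + \<alpha> q (\<lambda>_. v (s 2)) * apply2 \<omega> q (v (s 0)) (v (s 1))" for q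
      by (rule wedge_1_2) (rule smooth_form_alternating[OF a] smooth_form_alternating[OF w])+
    then show ?thesis
      unfolding A_def W_def DA_def DW_def
      by (simp add: frechet_derivative_at[symmetric,
        OF has_derivative_add[OF has_derivative_diff[OF has_derivative_mult[OF ha hw]
          has_derivative_mult[OF ha hw]] has_derivative_mult[OF ha hw]]])
  qed
  have E: "ext_deriv 3 (wedge 1 2 \<alpha> \<omega>) p v =
      (\<Sum>i\<le>3. (-1) ^ i * frechet_derivative (\<lambda>q. wedge 1 2 \<alpha> \<omega> q
        (\<lambda>m. v (if m < i then m else Suc m))) (at p) (v i))"
    unfolding ext_deriv_def by (simp add: if_distrib)
  have E2: "ext_deriv 2 \<omega> p (\<lambda>j. if j < i then v j else v (Suc j)) =
      (let s = (\<lambda>m. if m < i then m else Suc m) in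
       DW (s 1) (s 2) (s 0) - DW (s 0) (s 2) (s 1) + DW (s 0) (s 1) (s 2))" for i
    unfolding Let_def DW_def ext_deriv_2[OF w] by (simp add: if_distrib)
  have E1: "apply2 (ext_deriv 1 \<alpha>) p (v i) (v j) = DA j i - DA i j" for i j
    unfolding apply2_def ext_deriv_1[OF a] DA_def by simp
  have sum4: "(\<Sum>i\<le>3. f i) = f 0 + f 1 + f 2 + f 3" for f :: "nat \<Rightarrow> real"
    by (simp add: numeral_3_eq_3 numeral_2_eq_2)
  show ?thesis
    unfolding E D wedge_2_2[of "ext_deriv 1 \<alpha>" p \<omega>, OF smooth_form_alternating[OF smooth_form_ext_deriv_1[OF a]]
      smooth_form_alternating[OF w]] E1 E2 sum4 A_def[symmetric] W_def[symmetric] Let_def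
    by (simp add: algebra_simps flip: One_nat_def)
qed

section \<open>The forms in vector notation\<close>

text \<open>
  The vector of values \<open>(\<beta>\<^sub>1, \<beta>\<^sub>2, \<beta>\<^sub>3)\<close> at \<open>y\<close> on \<open>w\<close>. If \<open>\<real>\<^sup>4\<close> is read as the quaternions with
  the fourth basis vector as real unit, then this is \<open>2 Im(y\<^sup>* w)\<close>, which exhibits the left
  invariance and makes it a skew bilinear map in \<open>(y, w)\<close>.
\<close>

definition beta_vec :: "real^4 \<Rightarrow> real^4 \<Rightarrow> real^3" where
  "beta_vec y w = vector
    [2 * (y$4 * w$1 + y$3 * w$2 - y$2 * w$3 - y$1 * w$4),
     2 * (y$4 * w$2 + y$1 * w$3 - y$3 * w$1 - y$2 * w$4),
     2 * (y$4 * w$3 + y$2 * w$1 - y$1 * w$2 - y$3 * w$4)]"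

lemma bounded_bilinear_beta_vec: "bounded_bilinear beta_vec"
  unfolding bilinear_conv_bounded_bilinear[symmetric] bilinear_def
  by (intro conjI allI linearI) (simp_all add: beta_vec_def vec_eq_iff forall_3 algebra_simps)

lemma beta_vec_skew: "beta_vec w y = - beta_vec y w"
  by (simp add: beta_vec_def vec_eq_iff forall_3)

text \<open>
  The structure equations \<open>d\<beta>\<^sub>1 = -\<beta>\<^sub>2 \<and> \<beta>\<^sub>3\<close>, \<open>d\<beta>\<^sub>2 = \<beta>\<^sub>1 \<and> \<beta>\<^sub>3\<close>, \<open>d\<beta>\<^sub>3 = -\<beta>\<^sub>1 \<and> \<beta>\<^sub>2\<close> on the unit
  sphere: as \<open>\<beta>\<close> is linear in the point and skew, its exterior derivative on \<open>(v, w)\<close> is twice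
  its value at the point \<open>v\<close> on \<open>w\<close>.
\<close>

lemma beta_vec_tangent:
  assumes "norm y = 1" "y \<bullet> v = 0" "y \<bullet> w = 0"
  shows "2 *\<^sub>R beta_vec v w = - cross3 (beta_vec y v) (beta_vec y w)"
proof -
  have n: "y$1 * y$1 + y$2 * y$2 + y$3 * y$3 + y$4 * y$4 = 1"
    using assms(1) by (simp add: norm_eq_1 inner_vec_def sum_4)
  have v: "y$1 * v$1 + y$2 * v$2 + y$3 * v$3 + y$4 * v$4 = 0"
    and w: "y$1 * w$1 + y$2 * w$2 + y$3 * w$3 + y$4 * w$4 = 0"
    using assms(2,3) by (simp_all add: inner_vec_def sum_4)
  show ?thesis
    unfolding vec_eq_iff forall_3
    by (simp add: beta_vec_def cross_components; intro conjI; use n v w in algebra)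
qed

text \<open>
  Inverting quaternion multiplication, the vector with value \<open>c\<close> is \<open>y c / 2\<close>, where \<open>c\<close> is taken
  as an imaginary quaternion.
\<close>

lemma beta_vec_surj:
  assumes "norm y = 1"
  obtains w where "y \<bullet> w = 0" "beta_vec y w = c"
proof -
  have n: "y$1 * y$1 + y$2 * y$2 + y$3 * y$3 + y$4 * y$4 = 1"
    using assms(1) by (simp add: norm_eq_1 inner_vec_def sum_4)
  define w :: "real^4" where "w = vector
    [(y$4 * c$1 - y$3 * c$2 + y$2 * c$3) / 2,
     (y$3 * c$1 + y$4 * c$2 - y$1 * c$3) / 2,
     (y$1 * c$2 - y$2 * c$1 + y$4 * c$3) / 2,
     (- y$1 * c$1 - y$2 * c$2 - y$3 * c$3) / 2]"
  have w: "w$1 = (y$4 * c$1 - y$3 * c$2 + y$2 * c$3) / 2"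
     "w$2 = (y$3 * c$1 + y$4 * c$2 - y$1 * c$3) / 2"
     "w$3 = (y$1 * c$2 - y$2 * c$1 + y$4 * c$3) / 2"
     "w$4 = (- y$1 * c$1 - y$2 * c$2 - y$3 * c$3) / 2"
    unfolding w_def by (simp_all add: vector_def)
  show ?thesis
  proof
    show "y \<bullet> w = 0"
      by (simp add: inner_vec_def sum_4 w field_simps)
    show "beta_vec y w = c"
      unfolding vec_eq_iff forall_3 beta_vec_def
      by (simp add: w; intro conjI; use n in algebra)
  qed
qed

lemma has_derivative_beta_vec: "((\<lambda>q. beta_vec (snd q) w) has_derivative (\<lambda>h. beta_vec (snd h) w)) (at p)"
  by (intro bounded_linear_imp_has_derivative
      bounded_linear_compose[OF bounded_bilinear.bounded_linear_left[OF bounded_bilinear_beta_vec] bounded_linear_snd])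

lemma has_derivative_cross3:
  "((\<lambda>q. cross3 (fst q) c) has_derivative (\<lambda>h. cross3 (fst h) c)) (at p)"
proof -
  have "bounded_bilinear cross3"
    using bilinear_cross bilinear_conv_bounded_bilinear by blast
  then show ?thesis
    by (intro bounded_linear_imp_has_derivative
        bounded_linear_compose[OF bounded_bilinear.bounded_linear_left bounded_linear_fst])
qed

lemma coord_simps:
  "coord (Suc 0) p = fst p $ 1" "coord 2 p = fst p $ 2" "coord 3 p = fst p $ 3"
  "coord 5 p = snd p $ 1" "coord 6 p = snd p $ 2" "coord 7 p = snd p $ 3" "coord 8 p = snd p $ 4"
  by (simp_all add: coord_def)

lemma sum_1_3: "(\<Sum>j = 1..3::nat. f j) = f (Suc 0) + f 2 + (f 3 :: real)"
  by (simp add: numeral_3_eq_3 numeral_2_eq_2)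

lemma bounded_linear_coord: "bounded_linear (coord k)"
proof -
  have "coord k = (if k \<le> 3 then (\<lambda>p. fst p $ of_nat k) else (\<lambda>p. snd p $ of_nat (k - 4)))"
    by (simp add: coord_def fun_eq_iff)
  then show ?thesis
    by (simp add: bounded_linear_compose[OF bounded_linear_vec_nth bounded_linear_fst]
      bounded_linear_compose[OF bounded_linear_vec_nth bounded_linear_snd])
qed

lemma smooth_form_dx: "smooth_form 1 (dx k)"
proof -
  have "linear (coord k)" using bounded_linear_coord bounded_linear.linear by blast
  then show ?thesis
    by (simp add: smooth_form_def dx_def alternating_def Ck_const del: Ck.simps)
qed

lemma smooth_coord_dx: "smooth_form 1 (\<lambda>p v. c * coord j p * dx k p v)"
  by (intro smooth_form_mult Ck_cmult Ck_bounded_linear bounded_linear_coord smooth_form_dx)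

lemma smooth_form_alpha: "smooth_form 1 (alpha j)"
  unfolding alpha_def
  by (cases "j = 1"; cases "j = 2"; simp del: One_nat_def)
    (intro smooth_form_add smooth_form_diff smooth_coord_dx)+

lemma smooth_form_beta: "smooth_form 1 (beta j)"
  unfolding beta_def
  by (cases "j = 1"; cases "j = 2"; simp del: One_nat_def)
    (intro smooth_form_add smooth_form_diff smooth_coord_dx)+

lemma smooth_form_eta: "smooth_form 1 eta"
  unfolding eta_def
  by (intro smooth_form_scale smooth_form_sum smooth_form_mult Ck_bounded_linear
      bounded_linear_coord smooth_form_beta) auto

lemma smooth_form_wedge_1_1:
  "smooth_form 1 \<alpha> \<Longrightarrow> smooth_form 1 \<beta> \<Longrightarrow> smooth_form 2 (wedge 1 1 \<alpha> \<beta>)"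
  using smooth_form_wedge[of 1 \<alpha> 1 \<beta>] by (simp add: numeral_2_eq_2)

lemma smooth_form_vol_S2: "smooth_form 2 vol_S2"
proof -
  have "smooth_form 2 (\<lambda>p v. c * coord i p * wedge 1 1 (dx j) (dx k) p v)" for c i j k
    by (intro smooth_form_mult Ck_cmult Ck_bounded_linear bounded_linear_coord
        smooth_form_wedge_1_1 smooth_form_dx)
  from smooth_form_diff[OF smooth_form_add[OF this this] this, of "-1" 3 1 2 1 2 1 3 1 1 2 3]
  show ?thesis by (simp add: vol_S2_def)
qed

lemma smooth_form_omega1: "smooth_form 2 omega1"
  unfolding omega1_def
  by (intro smooth_form_scale smooth_form_sum smooth_form_wedge_1_1 smooth_form_alpha
      smooth_form_beta) auto

lemma smooth_form_omega2: "smooth_form 2 omega2"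
  unfolding omega2_def
  by (intro smooth_form_add smooth_form_scale smooth_form_sum smooth_form_wedge_1_1 smooth_form_dx
      smooth_form_beta smooth_form_vol_S2) auto

lemma beta_eq:
  "beta (Suc 0) p v = beta_vec (snd p) (snd (v 0)) $ 1"
  "beta 2 p v = beta_vec (snd p) (snd (v 0)) $ 2"
  "beta 3 p v = beta_vec (snd p) (snd (v 0)) $ 3"
  by (simp_all add: beta_def beta_vec_def dx_def coord_simps algebra_simps)

lemma alpha_eq:
  "alpha (Suc 0) p v = - 2 * cross3 (fst p) (fst (v 0)) $ 1"
  "alpha 2 p v = - 2 * cross3 (fst p) (fst (v 0)) $ 2"
  "alpha 3 p v = - 2 * cross3 (fst p) (fst (v 0)) $ 3"
  by (simp_all add: alpha_def cross_components dx_def coord_simps algebra_simps)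

lemma wedge_covectors:
  "wedge 1 1 (dx j) (dx k) p v = coord j (v 0) * coord k (v 1) - coord j (v 1) * coord k (v 0)"
  "wedge 1 1 (dx j) (beta k) p v = coord j (v 0) * beta k p (\<lambda>_. v 1) - coord j (v 1) * beta k p (\<lambda>_. v 0)"
  "wedge 1 1 (alpha j) (beta k) p v =
    alpha j p (\<lambda>_. v 0) * beta k p (\<lambda>_. v 1) - alpha j p (\<lambda>_. v 1) * beta k p (\<lambda>_. v 0)"
  using wedge_1_1[of "dx j" p "dx k"] wedge_1_1[of "dx j" p "beta k"] wedge_1_1[of "alpha j" p "beta k"]
    smooth_form_alternating[OF smooth_form_dx] smooth_form_alternating[OF smooth_form_alpha]
    smooth_form_alternating[OF smooth_form_beta]
  by (simp_all add: dx_def del: One_nat_def)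

text \<open>
  With \<open>x\<close> the point of the two-sphere, \<open>u\<close> the component of a tangent vector along it and
  \<open>b = (\<beta>\<^sub>1, \<beta>\<^sub>2, \<beta>\<^sub>3)\<close> its value under the left-invariant forms, all forms of the family are built
  from inner and cross products of \<open>x\<close>, \<open>u\<close> and \<open>b\<close>. This removes the dependence on the point of
  the three-sphere.
\<close>

lemma eta_eq: "eta p v = (fst p \<bullet> beta_vec (snd p) (snd (v 0))) / 3"
  by (simp add: eta_def sum_1_3[unfolded One_nat_def] beta_eq coord_simps inner_vec_def sum_3)

lemma vol_S2_eq: "vol_S2 p v = - (fst p \<bullet> cross3 (fst (v 0)) (fst (v 1)))"
  unfolding vol_S2_def
  by (simp add: wedge_covectors[unfolded One_nat_def] coord_simps inner_vec_def sum_3 cross_components algebra_simps)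

lemma omega1_eq: "omega1 p v = - (sqrt 3 / 9) *
    (cross3 (fst p) (fst (v 0)) \<bullet> beta_vec (snd p) (snd (v 1))
     - cross3 (fst p) (fst (v 1)) \<bullet> beta_vec (snd p) (snd (v 0)))"
  unfolding omega1_def sum_1_3
  by (simp add: wedge_covectors[unfolded One_nat_def] alpha_eq beta_eq inner_vec_def sum_3 algebra_simps)

lemma omega2_eq: "omega2 p v =
    - (2 * sqrt 3 / 9) * (fst p \<bullet> cross3 (fst (v 0)) (fst (v 1)))
    + sqrt 3 / 9 * (fst (v 0) \<bullet> beta_vec (snd p) (snd (v 1)) - fst (v 1) \<bullet> beta_vec (snd p) (snd (v 0)))"
  unfolding omega2_def sum_1_3 vol_S2_eq
  by (simp add: wedge_covectors[unfolded One_nat_def] coord_simps beta_eq inner_vec_def sum_3 algebra_simps)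

lemma ext_deriv_eta: "ext_deriv 1 eta p v =
    (fst (v 0) \<bullet> beta_vec (snd p) (snd (v 1)) - fst (v 1) \<bullet> beta_vec (snd p) (snd (v 0))
     + 2 * (fst p \<bullet> beta_vec (snd (v 0)) (snd (v 1)))) / 3"
proof -
  have D: "((\<lambda>q. eta q (\<lambda>_. X)) has_derivative
      (\<lambda>h. (fst h \<bullet> beta_vec (snd p) (snd X) + fst p \<bullet> beta_vec (snd h) (snd X)) / 3)) (at p)" for X
    unfolding eta_eq
    by (auto intro!: derivative_eq_intros has_derivative_beta_vec)
  show ?thesis
    unfolding ext_deriv_1[OF smooth_form_eta] frechet_derivative_at[OF D, symmetric]
    by (simp add: beta_vec_skew[of "snd (v (Suc 0))" "snd (v 0)"] field_simps)
qed

lemma ext_deriv_vol_S2: "ext_deriv 2 vol_S2 p v = - 3 * (fst (v 0) \<bullet> cross3 (fst (v 1)) (fst (v 2)))"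
proof -
  have D: "((\<lambda>q. apply2 vol_S2 q X Y) has_derivative
      (\<lambda>h. - (fst h \<bullet> cross3 (fst X) (fst Y)))) (at p)" for X Y
    unfolding apply2_def vol_S2_eq
    by (auto intro!: derivative_eq_intros)
  show ?thesis
    unfolding ext_deriv_2[OF smooth_form_vol_S2] frechet_derivative_at[OF D, symmetric]
    by (simp add: inner_vec_def sum_3 cross_components algebra_simps)
qed

lemma ext_deriv_ext_deriv_eta: "ext_deriv 2 (ext_deriv 1 eta) p v = 0"
proof -
  have D: "((\<lambda>q. apply2 (ext_deriv 1 eta) q X Y) has_derivative
      (\<lambda>h. (fst X \<bullet> beta_vec (snd h) (snd Y) - fst Y \<bullet> beta_vec (snd h) (snd X)
        + 2 * (fst h \<bullet> beta_vec (snd X) (snd Y))) / 3)) (at p)" for X Y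
    unfolding apply2_def ext_deriv_eta
    by (auto intro!: derivative_eq_intros has_derivative_beta_vec)
  show ?thesis
    unfolding ext_deriv_2[OF smooth_form_ext_deriv_1[OF smooth_form_eta]] frechet_derivative_at[OF D, symmetric]
    by (simp add: beta_vec_skew[of "snd (v (Suc 0))" "snd (v 0)"]
      beta_vec_skew[of "snd (v 2)" "snd (v 0)"] beta_vec_skew[of "snd (v 2)" "snd (v (Suc 0))"] field_simps)
qed

lemma ext_deriv_omega1: "ext_deriv 2 omega1 p v = - (sqrt 3 / 9) *
   (2 * (cross3 (fst (v 0)) (fst (v 1)) \<bullet> beta_vec (snd p) (snd (v 2))
       - cross3 (fst (v 0)) (fst (v 2)) \<bullet> beta_vec (snd p) (snd (v 1))
       + cross3 (fst (v 1)) (fst (v 2)) \<bullet> beta_vec (snd p) (snd (v 0)))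
  - 2 * (cross3 (fst p) (fst (v 0)) \<bullet> beta_vec (snd (v 1)) (snd (v 2))
       - cross3 (fst p) (fst (v 1)) \<bullet> beta_vec (snd (v 0)) (snd (v 2))
       + cross3 (fst p) (fst (v 2)) \<bullet> beta_vec (snd (v 0)) (snd (v 1))))"
proof -
  have D: "((\<lambda>q. apply2 omega1 q X Y) has_derivative
      (\<lambda>h. - (sqrt 3 / 9) * (cross3 (fst h) (fst X) \<bullet> beta_vec (snd p) (snd Y)
        + cross3 (fst p) (fst X) \<bullet> beta_vec (snd h) (snd Y)
        - (cross3 (fst h) (fst Y) \<bullet> beta_vec (snd p) (snd X)
        + cross3 (fst p) (fst Y) \<bullet> beta_vec (snd h) (snd X))))) (at p)" for X Y
    unfolding apply2_def omega1_eq
    by (auto intro!: derivative_eq_intros has_derivative_beta_vec has_derivative_cross3)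
  show ?thesis
    unfolding ext_deriv_2[OF smooth_form_omega1] frechet_derivative_at[OF D, symmetric]
    by (simp add: beta_vec_skew[of "snd (v (Suc 0))" "snd (v 0)"]
      beta_vec_skew[of "snd (v 2)" "snd (v 0)"] beta_vec_skew[of "snd (v 2)" "snd (v (Suc 0))"]
      cross_skew[of "fst (v (Suc 0))" "fst (v 0)"]
      cross_skew[of "fst (v 2)" "fst (v 0)"] cross_skew[of "fst (v 2)" "fst (v (Suc 0))"] field_simps)
qed

lemma ext_deriv_omega2: "ext_deriv 2 omega2 p v =
    - (2 * sqrt 3 / 3) * (fst (v 0) \<bullet> cross3 (fst (v 1)) (fst (v 2)))
    - 2 * sqrt 3 / 9 * (fst (v 0) \<bullet> beta_vec (snd (v 1)) (snd (v 2))
       - fst (v 1) \<bullet> beta_vec (snd (v 0)) (snd (v 2)) + fst (v 2) \<bullet> beta_vec (snd (v 0)) (snd (v 1)))"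
proof -
  have D: "((\<lambda>q. apply2 omega2 q X Y) has_derivative
      (\<lambda>h. - (2 * sqrt 3 / 9) * (fst h \<bullet> cross3 (fst X) (fst Y))
        + sqrt 3 / 9 * (fst X \<bullet> beta_vec (snd h) (snd Y) - fst Y \<bullet> beta_vec (snd h) (snd X)))) (at p)" for X Y
    unfolding apply2_def omega2_eq
    by (auto intro!: derivative_eq_intros has_derivative_beta_vec)
  have "fst (v 1) \<bullet> cross3 (fst (v 0)) (fst (v 2)) = - (fst (v 0) \<bullet> cross3 (fst (v 1)) (fst (v 2)))"
    "fst (v 2) \<bullet> cross3 (fst (v 0)) (fst (v 1)) = fst (v 0) \<bullet> cross3 (fst (v 1)) (fst (v 2))"
    by (simp_all add: inner_vec_def sum_3 cross_components algebra_simps)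
  then show ?thesis
    unfolding ext_deriv_2[OF smooth_form_omega2] frechet_derivative_at[OF D, symmetric]
    by (simp add: beta_vec_skew[of "snd (v (Suc 0))" "snd (v 0)"]
      beta_vec_skew[of "snd (v 2)" "snd (v 0)"] beta_vec_skew[of "snd (v 2)" "snd (v (Suc 0))"] field_simps)
qed

section \<open>Adapted frames\<close>

text \<open>
  The forms are invariant under rotating \<open>x\<close>, \<open>u\<close> and \<open>b\<close> simultaneously. Although the two-sphere
  has no global frame, at each single point \<open>x\<close> can be completed to a positively oriented
  orthonormal basis \<open>x, f, g\<close>, and in such a basis all forms get constant coefficients. The frame is
  used at one point only, after differentiation.
\<close>

locale adapted_frame =
  fixes p :: ambient and f g :: "real^3"
  assumes p: "p \<in> S2xS3"
    and f: "norm f = 1" "fst p \<bullet> f = 0"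
    and g: "g = cross3 (fst p) f"
begin

text \<open>
  A basis of the cotangent space at \<open>p\<close>: the first two covectors are the components of \<open>u\<close>
  along \<open>f\<close> and \<open>g\<close>, the other three are those of \<open>b\<close> along \<open>x\<close>, \<open>f\<close> and \<open>g\<close>.
\<close>

definition P :: "ambient \<Rightarrow> real" where "P X = f \<bullet> fst X"
definition Q :: "ambient \<Rightarrow> real" where "Q X = g \<bullet> fst X"
definition R :: "ambient \<Rightarrow> real" where "R X = fst p \<bullet> beta_vec (snd p) (snd X)"
definition S :: "ambient \<Rightarrow> real" where "S X = f \<bullet> beta_vec (snd p) (snd X)"
definition T :: "ambient \<Rightarrow> real" where "T X = g \<bullet> beta_vec (snd p) (snd X)"

abbreviation tangent :: "ambient \<Rightarrow> bool" where
  "tangent X \<equiv> X \<in> tangent_space S2xS3 p"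

lemma tangent_iff: "tangent X \<longleftrightarrow> fst p \<bullet> fst X = 0 \<and> snd p \<bullet> snd X = 0"
  using tangent_space_S2xS3[of "fst p" "snd p"] p by (simp add: case_prod_beta mem_Times_iff)

lemma norms: "norm (fst p) = 1" "norm (snd p) = 1"
  using p by (auto simp: S2xS3_def)

lemma frame_inner:
  "fst p \<bullet> fst p = 1" "f \<bullet> f = 1" "g \<bullet> g = 1"
  "fst p \<bullet> f = 0" "fst p \<bullet> g = 0" "f \<bullet> g = 0" "f \<bullet> fst p = 0" "g \<bullet> fst p = 0" "g \<bullet> f = 0"
proof -
  show 1: "fst p \<bullet> fst p = 1" "f \<bullet> f = 1" using norms f by (simp_all add: norm_eq_1)
  show "fst p \<bullet> f = 0" "f \<bullet> fst p = 0" using f by (simp_all add: inner_commute)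
  show "fst p \<bullet> g = 0" "f \<bullet> g = 0" "g \<bullet> fst p = 0" "g \<bullet> f = 0"
    by (simp_all add: g dot_cross_self)
  show "g \<bullet> g = 1"
    using norm_cross_dot[of "fst p" f] norms f by (simp add: g dot_square_norm)
qed

lemma frame_cross: "cross3 f g = fst p" "cross3 g (fst p) = f"
proof -
  show "cross3 f g = fst p"
    unfolding g Lagrange using frame_inner by simp
  have "cross3 g (fst p) = - cross3 (fst p) g" by (rule cross_skew)
  also have "\<dots> = f" unfolding g Lagrange using frame_inner by simp
  finally show "cross3 g (fst p) = f" .
qed

text \<open>
  The difference of the two sides is orthogonal to \<open>x\<close> and \<open>f\<close>, so its cross product with
  \<open>g = x \<times> f\<close> vanishes by Lagrange's identity; it is also orthogonal to \<open>g\<close>.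
\<close>

lemma expand: "a = (fst p \<bullet> a) *\<^sub>R fst p + (f \<bullet> a) *\<^sub>R f + (g \<bullet> a) *\<^sub>R g"
proof -
  define d where "d = a - ((fst p \<bullet> a) *\<^sub>R fst p + (f \<bullet> a) *\<^sub>R f + (g \<bullet> a) *\<^sub>R g)"
  have o: "fst p \<bullet> d = 0" "f \<bullet> d = 0" "g \<bullet> d = 0"
    by (simp_all add: d_def inner_diff_right inner_add_right frame_inner)
  have "cross3 d g = 0"
    unfolding g Lagrange using o by (simp add: inner_commute)
  then have "cross3 g d = 0" by (metis cross_skew neg_equal_0_iff_equal)
  moreover have "g \<noteq> 0" using frame_inner by auto
  ultimately have "d = 0"
    using cross_dot_cancel[of g d 0] o by simp
  then show ?thesis by (simp add: d_def)
qed

lemma inner_expand: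
  "a \<bullet> b = (fst p \<bullet> a) * (fst p \<bullet> b) + (f \<bullet> a) * (f \<bullet> b) + (g \<bullet> a) * (g \<bullet> b)"
  by (subst expand[of a]) (simp add: inner_add_left)

lemma cross_expand:
  "fst p \<bullet> cross3 a b = (f \<bullet> a) * (g \<bullet> b) - (g \<bullet> a) * (f \<bullet> b)"
  "f \<bullet> cross3 a b = (g \<bullet> a) * (fst p \<bullet> b) - (fst p \<bullet> a) * (g \<bullet> b)"
  "g \<bullet> cross3 a b = (fst p \<bullet> a) * (f \<bullet> b) - (f \<bullet> a) * (fst p \<bullet> b)"
proof -
  have c: "cross3 (fst p) f = g" "cross3 f (fst p) = - g" "cross3 g f = - fst p"
    "cross3 (fst p) g = - f"
    using g frame_cross cross_skew by metis+
  have *: "cross3 a b = cross3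
      ((fst p \<bullet> a) *\<^sub>R fst p + (f \<bullet> a) *\<^sub>R f + (g \<bullet> a) *\<^sub>R g)
      ((fst p \<bullet> b) *\<^sub>R fst p + (f \<bullet> b) *\<^sub>R f + (g \<bullet> b) *\<^sub>R g)"
    using expand[of a] expand[of b] by simp
  show "fst p \<bullet> cross3 a b = (f \<bullet> a) * (g \<bullet> b) - (g \<bullet> a) * (f \<bullet> b)"
    "f \<bullet> cross3 a b = (g \<bullet> a) * (fst p \<bullet> b) - (fst p \<bullet> a) * (g \<bullet> b)"
    "g \<bullet> cross3 a b = (fst p \<bullet> a) * (f \<bullet> b) - (f \<bullet> a) * (fst p \<bullet> b)"
    unfolding * by (simp_all add: cross_add_left cross_add_right cross_mult_left cross_mult_right
      frame_cross c inner_add_right inner_diff_right frame_inner)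
qed

lemma beta_vec_tangent_frame:
  assumes "tangent X" "tangent Y"
  shows "a \<bullet> beta_vec (snd X) (snd Y) =
    - (a \<bullet> cross3 (beta_vec (snd p) (snd X)) (beta_vec (snd p) (snd Y))) / 2"
proof -
  have "2 *\<^sub>R beta_vec (snd X) (snd Y) = - cross3 (beta_vec (snd p) (snd X)) (beta_vec (snd p) (snd Y))"
    using assms norms by (intro beta_vec_tangent) (simp_all add: tangent_iff)
  from arg_cong[OF this, of "\<lambda>c. a \<bullet> c"] show ?thesis by simp
qed

text \<open>
  The five covectors are independent on the tangent space, so any prescribed values are attained.
  All test vectors used below come from here.
\<close>

lemma frame_vector:
  obtains X where "tangent X" "P X = a" "Q X = b" "R X = c" "S X = d" "T X = e"
proof -
  obtain w where w: "snd p \<bullet> w = 0" "beta_vec (snd p) w = c *\<^sub>R fst p + d *\<^sub>R f + e *\<^sub>R g"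
    using beta_vec_surj[OF norms(2)] .
  show ?thesis
    by (rule that[of "(a *\<^sub>R f + b *\<^sub>R g, w)"])
      (simp_all add: tangent_iff P_def Q_def R_def S_def T_def w inner_add_right frame_inner)
qed

text \<open>
  From here on the forms are read as constant-coefficient expressions in the five covectors:
  \<open>\<eta> = R / 3\<close>, \<open>vol = - P Q\<close>, \<open>\<omega>\<^sub>1 = - (\<surd>3 / 9) (P T - Q S)\<close>,
  \<open>\<omega>\<^sub>2 = (\<surd>3 / 9) (- 2 P Q + P S + Q T)\<close> and \<open>d\<eta> = (P S + Q T - S T) / 3\<close>, with juxtaposition for
  the wedge product.
\<close>

lemma eta_frame: "eta p v = R (v 0) / 3"
  by (simp add: eta_eq R_def)

lemma vol_S2_frame: "apply2 vol_S2 p X Y = - (P X * Q Y - Q X * P Y)"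
  by (simp add: apply2_def vol_S2_eq cross_expand P_def Q_def)

lemma omega1_frame:
  assumes "tangent X" "tangent Y"
  shows "apply2 omega1 p X Y = - (sqrt 3 / 9) * (P X * T Y - Q X * S Y - P Y * T X + Q Y * S X)"
  using assms
  by (simp add: apply2_def omega1_eq tangent_iff inner_expand[of "cross3 _ _"] cross_expand frame_inner
    P_def Q_def S_def T_def)

lemma omega2_frame:
  assumes "tangent X" "tangent Y"
  shows "apply2 omega2 p X Y = sqrt 3 / 9 *
    (- 2 * (P X * Q Y - Q X * P Y) + P X * S Y - S X * P Y + Q X * T Y - T X * Q Y)"
  using assms
  by (simp add: apply2_def omega2_eq tangent_iff inner_expand[of "fst X"] inner_expand[of "fst Y"] cross_expand
    frame_inner P_def Q_def S_def T_def field_simps)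

lemma deta_frame:
  assumes "tangent X" "tangent Y"
  shows "apply2 (ext_deriv 1 eta) p X Y =
    (P X * S Y - S X * P Y + Q X * T Y - T X * Q Y - (S X * T Y - T X * S Y)) / 3"
  using assms
  by (simp add: apply2_def ext_deriv_eta[unfolded One_nat_def] beta_vec_tangent_frame cross_expand)
    (simp add: inner_expand[of "fst X"] inner_expand[of "fst Y"] tangent_iff P_def Q_def S_def T_def)

lemma P_Q_base: "P p = 0" "Q p = 0"
  by (simp_all add: P_def Q_def frame_inner)

text \<open>
  The volume form is closed because its derivative is a triple product of vectors that lie in the
  plane orthogonal to \<open>x\<close>.
\<close>

lemma d_vol_S2_frame:
  assumes "\<forall>i<3. tangent (v i)"
  shows "ext_deriv 2 vol_S2 p v = 0"
  using assms
  by (simp add: ext_deriv_vol_S2 inner_expand[of "fst (v 0)"] cross_expand tangent_iff)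

lemma wedge_1_2_frame:
  "smooth_form 2 \<omega> \<Longrightarrow> wedge 1 2 eta \<omega> p v = (R (v 0) * apply2 \<omega> p (v 1) (v 2)
    - R (v 1) * apply2 \<omega> p (v 0) (v 2) + R (v 2) * apply2 \<omega> p (v 0) (v 1)) / 3"
  using wedge_1_2[of eta p \<omega> v] smooth_form_alternating[OF smooth_form_eta]
  by (simp add: smooth_form_alternating eta_frame field_simps)

lemma d_omega1_frame:
  assumes "\<forall>i<3. tangent (v i)"
  shows "ext_deriv 2 omega1 p v = 3 * wedge 1 2 eta omega2 p v"
proof -
  have t: "tangent (v 0)" "tangent (v 1)" "tangent (v 2)" using assms by auto
  show ?thesis
    unfolding wedge_1_2_frame[OF smooth_form_omega2] ext_deriv_omega1
      omega2_frame[OF t(1,2)] omega2_frame[OF t(1,3)] omega2_frame[OF t(2,3)]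
      beta_vec_tangent_frame[OF t(1,2)] beta_vec_tangent_frame[OF t(1,3)] beta_vec_tangent_frame[OF t(2,3)]
    using t unfolding tangent_iff
    by (simp add: inner_expand[of "cross3 _ _"] cross_expand frame_inner
      P_def[symmetric] Q_def[symmetric] R_def[symmetric] S_def[symmetric] T_def[symmetric] P_Q_base)
      (simp add: field_simps)
qed

lemma d_omega2_frame:
  assumes "\<forall>i<3. tangent (v i)"
  shows "ext_deriv 2 omega2 p v = - 3 * wedge 1 2 eta omega1 p v"
proof -
  have t: "tangent (v 0)" "tangent (v 1)" "tangent (v 2)" using assms by auto
  show ?thesis
    unfolding wedge_1_2_frame[OF smooth_form_omega1] ext_deriv_omega2
      omega1_frame[OF t(1,2)] omega1_frame[OF t(1,3)] omega1_frame[OF t(2,3)]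
      beta_vec_tangent_frame[OF t(1,2)] beta_vec_tangent_frame[OF t(1,3)] beta_vec_tangent_frame[OF t(2,3)]
    using t unfolding tangent_iff
    by (simp add: inner_expand[of "fst (v _)" "cross3 _ _"] cross_expand frame_inner
      P_def[symmetric] Q_def[symmetric] R_def[symmetric] S_def[symmetric] T_def[symmetric] P_Q_base)
      (simp add: field_simps)
qed

text \<open>
  The 4-form \<open>P \<and> Q \<and> S \<and> T\<close>, written as the product of the 2-forms \<open>P \<and> Q\<close> and \<open>S \<and> T\<close>. It
  vanishes on the common kernel direction of \<open>\<omega>\<^sub>1, \<omega>\<^sub>2, \<omega>\<^sub>3\<close>, and all products of two forms of the
  family are multiples of it.
\<close>

definition PQST :: "(nat \<Rightarrow> ambient) \<Rightarrow> real" where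
  "PQST v = (let pq = (\<lambda>i j. P (v i) * Q (v j) - Q (v i) * P (v j));
       st = (\<lambda>i j. S (v i) * T (v j) - T (v i) * S (v j))
     in pq 0 1 * st 2 3 - pq 0 2 * st 1 3 + pq 0 3 * st 1 2
      + pq 1 2 * st 0 3 - pq 1 3 * st 0 2 + pq 2 3 * st 0 1)"

lemma wedge_2_2_frame:
  assumes "\<forall>i<4. tangent (v i)"
  shows "wedge 2 2 omega1 omega1 p v = - 2 / 27 * PQST v"
    "wedge 2 2 omega2 omega2 p v = - 2 / 27 * PQST v"
    "wedge 2 2 omega1 omega2 p v = 0"
    "wedge 2 2 omega1 vol_S2 p v = 0"
    "wedge 2 2 omega2 vol_S2 p v = 0"
    "wedge 2 2 omega1 (ext_deriv 1 eta) p v = 0"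
    "wedge 2 2 omega2 (ext_deriv 1 eta) p v = 0"
    "wedge 2 2 (ext_deriv 1 eta) (ext_deriv 1 eta) p v = - 2 / 9 * PQST v"
    "wedge 2 2 (ext_deriv 1 eta) vol_S2 p v = 1 / 3 * PQST v"
    "wedge 2 2 vol_S2 vol_S2 p v = 0"
proof -
  have t: "tangent (v 0)" "tangent (v 1)" "tangent (v 2)" "tangent (v 3)" using assms by auto
  note t = t[unfolded One_nat_def]
  note alt = smooth_form_alternating[OF smooth_form_omega1] smooth_form_alternating[OF smooth_form_omega2]
    smooth_form_alternating[OF smooth_form_vol_S2]
    smooth_form_alternating[OF smooth_form_ext_deriv_1[OF smooth_form_eta]]
  note F = omega1_frame omega2_frame deta_frame[unfolded One_nat_def] vol_S2_frame
  have s: "sqrt 3 * (sqrt 3 * x) = 3 * x" for x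
    by (simp flip: mult.assoc)
  show "wedge 2 2 omega1 omega1 p v = - 2 / 27 * PQST v"
    unfolding wedge_2_2[of omega1 p omega1, OF alt(1) alt(1)]
    by (simp add: F t PQST_def) (simp add: field_simps s)
  show "wedge 2 2 omega2 omega2 p v = - 2 / 27 * PQST v"
    unfolding wedge_2_2[of omega2 p omega2, OF alt(2) alt(2)]
    by (simp add: F t PQST_def) (simp add: field_simps s)
  show "wedge 2 2 omega1 omega2 p v = 0"
    unfolding wedge_2_2[of omega1 p omega2, OF alt(1) alt(2)]
    by (simp add: F t) (simp add: field_simps s)
  show "wedge 2 2 omega1 vol_S2 p v = 0"
    unfolding wedge_2_2[of omega1 p vol_S2, OF alt(1) alt(3)]
    by (simp add: F t) (simp add: field_simps s)
  show "wedge 2 2 omega2 vol_S2 p v = 0"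
    unfolding wedge_2_2[of omega2 p vol_S2, OF alt(2) alt(3)]
    by (simp add: F t) (simp add: field_simps s)
  show "wedge 2 2 omega1 (ext_deriv 1 eta) p v = 0"
    unfolding wedge_2_2[of omega1 p "ext_deriv 1 eta", OF alt(1) alt(4)]
    by (simp add: F t) (simp add: field_simps s)
  show "wedge 2 2 omega2 (ext_deriv 1 eta) p v = 0"
    unfolding wedge_2_2[of omega2 p "ext_deriv 1 eta", OF alt(2) alt(4)]
    by (simp add: F t) (simp add: field_simps s)
  show "wedge 2 2 (ext_deriv 1 eta) (ext_deriv 1 eta) p v = - 2 / 9 * PQST v"
    unfolding wedge_2_2[of "ext_deriv 1 eta" p "ext_deriv 1 eta", OF alt(4) alt(4)]
    by (simp add: F t PQST_def) (simp add: field_simps s)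
  show "wedge 2 2 (ext_deriv 1 eta) vol_S2 p v = 1 / 3 * PQST v"
    unfolding wedge_2_2[of "ext_deriv 1 eta" p vol_S2, OF alt(4) alt(3)]
    by (simp add: F t PQST_def) (simp add: field_simps s)
  show "wedge 2 2 vol_S2 vol_S2 p v = 0"
    unfolding wedge_2_2[of vol_S2 p vol_S2, OF alt(3) alt(3)]
    by (simp add: F t) (simp add: field_simps s)
qed

end

lemma adapted_frame_exists:
  assumes "p \<in> S2xS3"
  obtains f g where "adapted_frame p f g"
proof -
  obtain y :: "real^3" where "y \<noteq> 0" "orthogonal (fst p) y"
    by (rule orthogonal_to_vector_exists[of "fst p"]) auto
  then have "norm (y /\<^sub>R norm y) = 1" "fst p \<bullet> (y /\<^sub>R norm y) = 0"
    by (simp_all add: orthogonal_def)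
  then show ?thesis
    using that[of "y /\<^sub>R norm y" "cross3 (fst p) (y /\<^sub>R norm y)"] assms
    by (simp add: adapted_frame_def)
qed

section \<open>The family of SU(2)-structures\<close>

lemma wedge_2_2_commute:
  "alternating 2 (\<alpha> p) \<Longrightarrow> alternating 2 (\<beta> p) \<Longrightarrow> wedge 2 2 \<alpha> \<beta> p v = wedge 2 2 \<beta> \<alpha> p v"
  using wedge_2_2[of \<alpha> p \<beta> v] wedge_2_2[of \<beta> p \<alpha> v] by (simp add: mult_ac)

lemma smooth_forms_tilde:
  "smooth_form 2 (omega1_tilde lam mu)" "smooth_form 2 (omega2_tilde lam mu)"
  "smooth_form 2 (omega3_tilde lam mu)"
  unfolding omega1_tilde_def omega2_tilde_def omega3_tilde_def
  by (intro smooth_form_scale smooth_form_add smooth_form_omega1 smooth_form_omega2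
      smooth_form_vol_S2 smooth_form_ext_deriv_1 smooth_form_eta)+

lemma apply2_tilde:
  "apply2 (omega1_tilde lam mu) p X Y = sqrt (3 * lam * (lam - 3 * mu)) * apply2 omega1 p X Y"
  "apply2 (omega2_tilde lam mu) p X Y = sqrt (3 * lam * (lam - 3 * mu)) * apply2 omega2 p X Y"
  "apply2 (omega3_tilde lam mu) p X Y =
    lam * apply2 (ext_deriv 1 eta) p X Y + mu * apply2 vol_S2 p X Y"
  by (simp_all add: apply2_def omega1_tilde_def omega2_tilde_def omega3_tilde_def)

context adapted_frame
begin

text \<open>
  When \<open>d\<omega> = c \<eta> \<and> \<psi>\<close>, the second term of the Leibniz rule contains \<open>\<eta> \<and> \<eta> = 0\<close>. The case
  \<open>c = 0\<close> covers closed forms.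
\<close>

lemma d_eta_wedge_frame:
  assumes w: "smooth_form 2 \<omega>" and s: "smooth_form 2 \<psi>"
    and d: "\<And>w. \<forall>i<3. tangent (w i) \<Longrightarrow> ext_deriv 2 \<omega> p w = c * wedge 1 2 eta \<psi> p w"
    and v: "\<forall>i<4. tangent (v i)"
  shows "ext_deriv 3 (wedge 1 2 eta \<omega>) p v = wedge 2 2 (ext_deriv 1 eta) \<omega> p v"
proof -
  have sum4: "(\<Sum>i\<le>3. F i) = F 0 + F 1 + F 2 + F 3" for F :: "nat \<Rightarrow> real"
    by (simp add: numeral_3_eq_3 numeral_2_eq_2)
  have "ext_deriv 2 \<omega> p (\<lambda>j. if j < i then v j else v (Suc j)) =
      c * wedge 1 2 eta \<psi> p (\<lambda>j. if j < i then v j else v (Suc j))" if "i \<le> 3" for i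
    by (rule d) (use v that in auto)
  then have "(\<Sum>i\<le>3. (-1) ^ i * eta p (\<lambda>_. v i) * ext_deriv 2 \<omega> p (\<lambda>j. if j < i then v j else v (Suc j)))
      = (\<Sum>i\<le>3. (-1) ^ i * eta p (\<lambda>_. v i) * (c * wedge 1 2 eta \<psi> p (\<lambda>j. if j < i then v j else v (Suc j))))"
    by simp
  also have "\<dots> = 0"
    unfolding sum4 wedge_1_2_frame[OF s] eta_frame
    by (simp add: field_simps flip: One_nat_def)
  finally show ?thesis
    using ext_deriv_wedge_1_2[OF smooth_form_eta w] by simp
qed

lemma d_tilde_frame:
  assumes "\<forall>i<3. tangent (v i)"
  shows "ext_deriv 2 (omega1_tilde lam mu) p v = 3 * wedge 1 2 eta (omega2_tilde lam mu) p v"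
    "ext_deriv 2 (omega2_tilde lam mu) p v = - 3 * wedge 1 2 eta (omega1_tilde lam mu) p v"
    "ext_deriv 2 (omega3_tilde lam mu) p v = 0"
  using d_omega1_frame[OF assms] d_omega2_frame[OF assms] d_vol_S2_frame[OF assms]
    ext_deriv_ext_deriv_eta[of p v]
    ext_deriv_add[OF smooth_form_scale[OF smooth_form_ext_deriv_1[OF smooth_form_eta]]
      smooth_form_scale[OF smooth_form_vol_S2], of lam mu]
  unfolding omega1_tilde_def omega2_tilde_def omega3_tilde_def wedge_scale
    ext_deriv_scale[OF smooth_form_omega1] ext_deriv_scale[OF smooth_form_omega2]
    ext_deriv_scale[OF smooth_form_vol_S2]
    ext_deriv_scale[OF smooth_form_ext_deriv_1[OF smooth_form_eta]]
  by simp_all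

text \<open>
  The square of \<open>\<omega>\<^sub>3\<close> contributes \<open>-2\<lambda>\<^sup>2/9 + 2\<lambda>\<mu>/3\<close> times \<open>P Q S T\<close>. The factor
  \<open>\<surd>(3\<lambda>(\<lambda> - 3\<mu>))\<close> is exactly what makes the other two squares agree with it, and the two bounds on
  the parameters ensure that the radicand is positive.
\<close>

lemma wedge_tilde_frame:
  assumes pos: "lam < 0" "mu > lam / 3" and v: "\<forall>i<4. tangent (v i)"
  defines "c \<equiv> - 2 / 9 * lam * (lam - 3 * mu)"
  shows "wedge 2 2 (omega1_tilde lam mu) (omega1_tilde lam mu) p v = c * PQST v"
    "wedge 2 2 (omega2_tilde lam mu) (omega2_tilde lam mu) p v = c * PQST v"
    "wedge 2 2 (omega3_tilde lam mu) (omega3_tilde lam mu) p v = c * PQST v"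
    "wedge 2 2 (omega1_tilde lam mu) (omega2_tilde lam mu) p v = 0"
    "wedge 2 2 (omega1_tilde lam mu) (omega3_tilde lam mu) p v = 0"
    "wedge 2 2 (omega2_tilde lam mu) (omega3_tilde lam mu) p v = 0"
    "wedge 2 2 (ext_deriv 1 eta) (omega1_tilde lam mu) p v = 0"
    "wedge 2 2 (ext_deriv 1 eta) (omega2_tilde lam mu) p v = 0"
    "wedge 2 2 (ext_deriv 1 eta) (omega3_tilde lam mu) p v = (- 2 / 9 * lam + mu / 3) * PQST v"
proof -
  note alt = smooth_form_alternating[OF smooth_form_omega1] smooth_form_alternating[OF smooth_form_omega2]
    smooth_form_alternating[OF smooth_form_vol_S2]
    smooth_form_alternating[OF smooth_form_ext_deriv_1[OF smooth_form_eta]]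
  note W = wedge_2_2_frame[OF v]
  note C = wedge_2_2_commute[of vol_S2 p "ext_deriv 1 eta", OF alt(3,4)]
    wedge_2_2_commute[of "ext_deriv 1 eta" p omega1, OF alt(4,1)]
    wedge_2_2_commute[of "ext_deriv 1 eta" p omega2, OF alt(4,2)]
  have "lam * (lam - 3 * mu) > 0"
    using pos by (simp add: mult_neg_neg)
  then have k: "sqrt (3 * lam * (lam - 3 * mu)) * sqrt (3 * lam * (lam - 3 * mu)) = 3 * lam * (lam - 3 * mu)"
    by simp
  show "wedge 2 2 (omega1_tilde lam mu) (omega1_tilde lam mu) p v = c * PQST v"
    "wedge 2 2 (omega2_tilde lam mu) (omega2_tilde lam mu) p v = c * PQST v"
    unfolding omega1_tilde_def omega2_tilde_def wedge_scale W mult.assoc[symmetric] k c_def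
    by (simp_all add: field_simps)
  show "wedge 2 2 (omega3_tilde lam mu) (omega3_tilde lam mu) p v = c * PQST v"
    "wedge 2 2 (ext_deriv 1 eta) (omega3_tilde lam mu) p v = (- 2 / 9 * lam + mu / 3) * PQST v"
    unfolding omega3_tilde_def wedge_scale wedge_add C W c_def
    by (simp_all add: field_simps)
  show "wedge 2 2 (omega1_tilde lam mu) (omega2_tilde lam mu) p v = 0"
    "wedge 2 2 (omega1_tilde lam mu) (omega3_tilde lam mu) p v = 0"
    "wedge 2 2 (omega2_tilde lam mu) (omega3_tilde lam mu) p v = 0"
    "wedge 2 2 (ext_deriv 1 eta) (omega1_tilde lam mu) p v = 0"
    "wedge 2 2 (ext_deriv 1 eta) (omega2_tilde lam mu) p v = 0"
    unfolding omega1_tilde_def omega2_tilde_def omega3_tilde_def wedge_scale wedge_add C W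
    by simp_all
qed

text \<open>
  Testing the equation of 1-forms on the dual basis determines \<open>Y\<close> from \<open>X\<close> up to its \<open>R\<close>-component:
  \<open>P Y = Q X\<close>, \<open>Q Y = - P X\<close>, \<open>S Y = - 2 P X - T X\<close>, \<open>T Y = S X - 2 Q X\<close>. Substituting this,
  \<open>\<omega>\<^sub>3(X, Y)\<close> becomes a sum of squares with the weights \<open>- \<lambda>/3\<close> and \<open>\<mu> - \<lambda>/3\<close>.
\<close>

lemma positivity_frame:
  assumes pos: "lam < 0" "mu > lam / 3" and X: "tangent X" and Y: "tangent Y"
    and eq: "\<And>Z. tangent Z \<Longrightarrow> apply2 (omega1_tilde lam mu) p X Z = apply2 (omega2_tilde lam mu) p Y Z"
  shows "apply2 (omega3_tilde lam mu) p X Y \<ge> 0"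
proof -
  have eq': "apply2 omega1 p X Z = apply2 omega2 p Y Z" if "tangent Z" for Z
    using eq[OF that] pos by (auto simp: apply2_tilde)
  have eq'': "- (P X * T Z - Q X * S Z - P Z * T X + Q Z * S X) =
      - 2 * (P Y * Q Z - Q Y * P Z) + P Y * S Z - S Y * P Z + Q Y * T Z - T Y * Q Z" if "tangent Z" for Z
    using eq'[OF that] unfolding omega1_frame[OF X that] omega2_frame[OF Y that]
      mult_minus_left mult_minus_right[symmetric] by simp
  have Y1: "P Y = Q X"
    by (rule frame_vector[of 0 0 0 1 0]) (use eq'' in fastforce)
  have Y2: "Q Y = - P X"
    by (rule frame_vector[of 0 0 0 0 1]) (use eq'' in fastforce)
  have "S Y = 2 * Q Y - T X"
    by (rule frame_vector[of 1 0 0 0 0]) (use eq'' in fastforce)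
  then have Y3: "S Y = - 2 * P X - T X" by (simp add: Y2)
  have "T Y = S X - 2 * P Y"
    by (rule frame_vector[of 0 1 0 0 0]) (use eq'' in fastforce)
  then have Y4: "T Y = S X - 2 * Q X" by (simp add: Y1)
  have "apply2 (omega3_tilde lam mu) p X Y =
      (- lam / 3) * ((P X + T X)\<^sup>2 + (Q X - S X)\<^sup>2) + (mu - lam / 3) * ((P X)\<^sup>2 + (Q X)\<^sup>2)"
    unfolding apply2_tilde deta_frame[OF X Y] vol_S2_frame Y1 Y2 Y3 Y4
    by (simp add: field_simps power2_eq_square)
  also have "\<dots> \<ge> 0"
    using pos by (intro add_nonneg_nonneg mult_nonneg_nonneg) auto
  finally show ?thesis .
qed

lemma PQST_basis:
  obtains v where "\<forall>i<5. tangent (v i)" "PQST v = 1" "\<forall>i<4. R (v i) = 0" "R (v 4) = 1"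
proof -
  obtain X0 where 0: "tangent X0" "P X0 = 1" "Q X0 = 0" "R X0 = 0" "S X0 = 0" "T X0 = 0"
    by (rule frame_vector)
  obtain X1 where 1: "tangent X1" "P X1 = 0" "Q X1 = 1" "R X1 = 0" "S X1 = 0" "T X1 = 0"
    by (rule frame_vector)
  obtain X2 where 2: "tangent X2" "P X2 = 0" "Q X2 = 0" "R X2 = 0" "S X2 = 1" "T X2 = 0"
    by (rule frame_vector)
  obtain X3 where 3: "tangent X3" "P X3 = 0" "Q X3 = 0" "R X3 = 0" "S X3 = 0" "T X3 = 1"
    by (rule frame_vector)
  obtain X4 where 4: "tangent X4" "P X4 = 0" "Q X4 = 0" "R X4 = 1" "S X4 = 0" "T X4 = 0"
    by (rule frame_vector)
  show ?thesis
    by (rule that[of "\<lambda>i. [X0, X1, X2, X3, X4] ! i"])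
      (use 0 1 2 3 4 in \<open>auto simp: less_Suc_eq numeral_eq_Suc PQST_def\<close>)
qed

end

lemma su2_structure_tilde:
  assumes pos: "lam < 0" "mu > lam / 3"
  shows "su2_structure S2xS3 eta (omega1_tilde lam mu) (omega2_tilde lam mu) (omega3_tilde lam mu)"
proof -
  let ?o1 = "omega1_tilde lam mu" and ?o2 = "omega2_tilde lam mu" and ?o3 = "omega3_tilde lam mu"
  let ?nu = "wedge 2 2 ?o3 ?o3"
  have nu: "smooth_form 4 ?nu"
    using smooth_form_wedge[OF smooth_forms_tilde(3) smooth_forms_tilde(3)] by simp
  have prod: "eq_forms_on S2xS3 4 (wedge 2 2 ([?o1, ?o2, ?o3] ! i) ([?o1, ?o2, ?o3] ! j))
      (\<lambda>p v. if i = j then ?nu p v else 0)" if ij: "i < 3" "j < 3" for i j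
    unfolding eq_forms_on_def
  proof (intro ballI allI impI)
    fix p and v :: "nat \<Rightarrow> ambient" assume p: "p \<in> S2xS3" and v: "\<forall>i<4. v i \<in> tangent_space S2xS3 p"
    obtain f g where "adapted_frame p f g" using adapted_frame_exists[OF p] .
    then interpret adapted_frame p f g .
    note W = wedge_tilde_frame[OF pos, of v]
    note alt = smooth_forms_tilde[THEN smooth_form_alternating, of lam mu p]
    note C = wedge_2_2_commute[of ?o2 p ?o1, OF alt(2,1)] wedge_2_2_commute[of ?o3 p ?o1, OF alt(3,1)]
      wedge_2_2_commute[of ?o3 p ?o2, OF alt(3,2)]
    have "i = 0 \<or> i = 1 \<or> i = 2" "j = 0 \<or> j = 1 \<or> j = 2" using ij by auto
    then show "wedge 2 2 ([?o1, ?o2, ?o3] ! i) ([?o1, ?o2, ?o3] ! j) p v = (if i = j then ?nu p v else 0)"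
      using v by (elim disjE) (simp_all add: W C)
  qed
  have nz: "nowhere_zero_on S2xS3 5 (wedge 4 1 ?nu eta)"
    unfolding nowhere_zero_on_def
  proof
    fix p assume p: "p \<in> S2xS3"
    obtain f g where "adapted_frame p f g" using adapted_frame_exists[OF p] .
    then interpret adapted_frame p f g .
    obtain v where v: "\<forall>i<5. tangent (v i)" "PQST v = 1" "\<forall>i<4. R (v i) = 0" "R (v 4) = 1"
      using PQST_basis .
    have "wedge 4 1 ?nu eta p v = ?nu p v * eta p (\<lambda>_. v 4)"
      by (rule wedge_1_right_last[of 4 ?nu p eta, OF smooth_form_alternating[OF nu]
            smooth_form_alternating[OF smooth_form_eta]]) (simp add: eta_frame v)
    also have "\<dots> \<noteq> 0"
      using wedge_tilde_frame(3)[OF pos, of v] v pos by (auto simp: eta_frame)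
    finally show "\<exists>v. (\<forall>i<5. v i \<in> tangent_space S2xS3 p) \<and> wedge 4 1 ?nu eta p v \<noteq> 0"
      using v(1) by blast
  qed
  have "apply2 ?o3 p X Y \<ge> 0"
    if p: "p \<in> S2xS3" and XY: "X \<in> tangent_space S2xS3 p" "Y \<in> tangent_space S2xS3 p"
      "\<forall>Z\<in>tangent_space S2xS3 p. apply2 ?o1 p X Z = apply2 ?o2 p Y Z" for p X Y
  proof -
    obtain f g where "adapted_frame p f g" using adapted_frame_exists[OF p] .
    then interpret adapted_frame p f g .
    show ?thesis using positivity_frame[OF pos] XY by blast
  qed
  then show ?thesis
    unfolding su2_structure_def using smooth_forms_tilde smooth_form_eta nu prod nz by blast
qed

lemma hypo_tilde:
  assumes pos: "lam < 0" "mu > lam / 3"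
  shows "hypo S2xS3 eta (omega1_tilde lam mu) (omega2_tilde lam mu) (omega3_tilde lam mu)"
proof -
  have "ext_deriv 2 (omega3_tilde lam mu) p v = 0"
    if p: "p \<in> S2xS3" and t: "\<forall>i<3. v i \<in> tangent_space S2xS3 p" for p v
  proof -
    obtain f g where "adapted_frame p f g" using adapted_frame_exists[OF p] .
    then interpret adapted_frame p f g .
    show ?thesis using d_tilde_frame(3) t by blast
  qed
  moreover have "ext_deriv 3 (wedge 1 2 eta (omega1_tilde lam mu)) p v = 0 \<and>
      ext_deriv 3 (wedge 1 2 eta (omega2_tilde lam mu)) p v = 0"
    if p: "p \<in> S2xS3" and t: "\<forall>i<4. v i \<in> tangent_space S2xS3 p" for p v
  proof -
    obtain f g where "adapted_frame p f g" using adapted_frame_exists[OF p] .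
    then interpret adapted_frame p f g .
    show ?thesis
      using d_eta_wedge_frame[OF smooth_forms_tilde(1,2) d_tilde_frame(1), of v]
        d_eta_wedge_frame[OF smooth_forms_tilde(2,1) d_tilde_frame(2), of v]
        wedge_tilde_frame(7,8)[OF pos, of v] t
      by simp
  qed
  ultimately show ?thesis
    unfolding hypo_def eq_forms_on_def using su2_structure_tilde[OF pos] by blast
qed

lemma d_omega12_tilde:
  "eq_forms_on S2xS3 3 (ext_deriv 2 (omega1_tilde lam mu)) (\<lambda>p v. 3 * wedge 1 2 eta (omega2_tilde lam mu) p v)"
  "eq_forms_on S2xS3 3 (ext_deriv 2 (omega2_tilde lam mu)) (\<lambda>p v. - 3 * wedge 1 2 eta (omega1_tilde lam mu) p v)"
  unfolding eq_forms_on_def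
  by (metis adapted_frame.d_tilde_frame adapted_frame_exists)+

text \<open>
  The equation \<open>d\<omega>\<^sub>1 = 3 \<eta> \<and> \<omega>\<^sub>2\<close> is homogeneous in \<open>(\<omega>\<^sub>1, \<omega>\<^sub>2)\<close>, so it holds for the whole family.
  Both sides of the remaining equation are constant multiples of \<open>P Q S T\<close>, and comparing the two
  constants gives one equation for \<open>\<lambda>\<close> and \<open>\<mu>\<close>.
\<close>

lemma nearly_hypo_tilde_iff:
  assumes pos: "lam < 0" "mu > lam / 3"
  shows "nearly_hypo S2xS3 eta (omega1_tilde lam mu) (omega2_tilde lam mu) (omega3_tilde lam mu)
    \<longleftrightarrow> 3 * mu * (4 * lam + 1) = lam * (4 * lam + 2)"
proof -
  let ?L = "\<lambda>p v. ext_deriv 3 (wedge 1 2 eta (omega3_tilde lam mu)) p v"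
  let ?R = "\<lambda>p v. - 2 * wedge 2 2 (omega1_tilde lam mu) (omega1_tilde lam mu) p v"
  have LR: "?L p v = (- 2 / 9 * lam + mu / 3) * adapted_frame.PQST p f g v"
      "?R p v = 4 / 9 * lam * (lam - 3 * mu) * adapted_frame.PQST p f g v"
    if "adapted_frame p f g" "\<forall>i<4. v i \<in> tangent_space S2xS3 p" for p f g v
  proof -
    interpret adapted_frame p f g by fact
    show "?L p v = (- 2 / 9 * lam + mu / 3) * PQST v" "?R p v = 4 / 9 * lam * (lam - 3 * mu) * PQST v"
      using d_eta_wedge_frame[OF smooth_forms_tilde(3,1), of lam mu 0 lam mu v] d_tilde_frame(3)
        wedge_tilde_frame(1,9)[OF pos, of v] that(2)
      by simp_all
  qed
  have *: "- 2 / 9 * lam + mu / 3 = 4 / 9 * lam * (lam - 3 * mu) \<longleftrightarrow>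
      3 * mu * (4 * lam + 1) = lam * (4 * lam + 2)"
    by (auto simp: field_simps)
  have "eq_forms_on S2xS3 4 ?L ?R \<longleftrightarrow> - 2 / 9 * lam + mu / 3 = 4 / 9 * lam * (lam - 3 * mu)"
  proof
    assume E: "eq_forms_on S2xS3 4 ?L ?R"
    have "(axis 1 1, axis 1 1) \<in> S2xS3" by (simp add: S2xS3_def)
    then obtain p f g where fr: "adapted_frame p f g" using adapted_frame_exists by metis
    then interpret adapted_frame p f g .
    obtain v where v: "\<forall>i<5. tangent (v i)" "PQST v = 1"
      using PQST_basis .
    then have t: "\<forall>i<4. tangent (v i)" by simp
    have "?L p v = ?R p v" using E p t by (simp add: eq_forms_on_def)
    then show "- 2 / 9 * lam + mu / 3 = 4 / 9 * lam * (lam - 3 * mu)"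
      unfolding LR[OF fr t] using v by simp
  next
    assume E: "- 2 / 9 * lam + mu / 3 = 4 / 9 * lam * (lam - 3 * mu)"
    show "eq_forms_on S2xS3 4 ?L ?R"
      unfolding eq_forms_on_def
    proof (intro ballI allI impI)
      fix p and v :: "nat \<Rightarrow> ambient" assume p: "p \<in> S2xS3" and t: "\<forall>i<4. v i \<in> tangent_space S2xS3 p"
      obtain f g where fr: "adapted_frame p f g" using adapted_frame_exists[OF p] .
      show "?L p v = ?R p v" unfolding LR[OF fr t] E ..
    qed
  qed
  then show ?thesis
    unfolding nearly_hypo_def * using su2_structure_tilde[OF pos] d_omega12_tilde by simp
qed

text \<open>
  The equation amounts to \<open>(3\<mu> - \<lambda>)(4\<lambda> + 1) = \<lambda>\<close>. As the first factor is positive and the right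
  side negative, \<open>4\<lambda> + 1\<close> is negative.
\<close>

lemma double_hypo_parameters:
  fixes lam mu :: real
  assumes pos: "lam < 0" "mu > lam / 3"
  shows "3 * mu * (4 * lam + 1) = lam * (4 * lam + 2) \<longleftrightarrow>
    lam < - 1 / 4 \<and> mu = lam * (4 * lam + 2) / (3 * (4 * lam + 1))"
proof
  assume E: "3 * mu * (4 * lam + 1) = lam * (4 * lam + 2)"
  then have "(3 * mu - lam) * (4 * lam + 1) = lam" by (simp add: algebra_simps)
  then have "(3 * mu - lam) * (4 * lam + 1) < 0" using pos by simp
  then have "4 * lam + 1 < 0" using pos by (simp add: mult_less_0_iff)
  then show "lam < - 1 / 4 \<and> mu = lam * (4 * lam + 2) / (3 * (4 * lam + 1))"
    using E by (simp add: eq_divide_eq mult_ac)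
next
  assume a: "lam < - 1 / 4 \<and> mu = lam * (4 * lam + 2) / (3 * (4 * lam + 1))"
  then have "3 * (4 * lam + 1) \<noteq> 0" by auto
  with a have "mu * (3 * (4 * lam + 1)) = lam * (4 * lam + 2)"
    using nonzero_eq_divide_eq by blast
  then show "3 * mu * (4 * lam + 1) = lam * (4 * lam + 2)" by (simp add: algebra_simps)
qed

text \<open>
  The equations for \<open>d\<omega>\<^sub>1\<close> and \<open>d\<omega>\<^sub>2\<close> hold for all parameters. The remaining one says
  \<open>(1 + 2\<lambda>) d\<eta> + 2\<mu> vol = 0\<close>, and \<open>d\<eta>\<close> and \<open>vol\<close> are independent: of the two, only \<open>d\<eta>\<close> contains
  \<open>S T\<close>, and only \<open>vol\<close> is nonzero on the pair dual to \<open>P, Q\<close>.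
\<close>

lemma sasaki_einstein_tilde_iff:
  assumes pos: "lam < 0" "mu > lam / 3"
  shows "sasaki_einstein S2xS3 eta (omega1_tilde lam mu) (omega2_tilde lam mu) (omega3_tilde lam mu)
    \<longleftrightarrow> lam = - 1 / 2 \<and> mu = 0"
proof -
  have "eq_forms_on S2xS3 2 (ext_deriv 1 eta) (\<lambda>p v. - 2 * omega3_tilde lam mu p v) \<longleftrightarrow>
      lam = - 1 / 2 \<and> mu = 0"
  proof
    assume E: "eq_forms_on S2xS3 2 (ext_deriv 1 eta) (\<lambda>p v. - 2 * omega3_tilde lam mu p v)"
    have "(axis 1 1, axis 1 1) \<in> S2xS3" by (simp add: S2xS3_def)
    then obtain p f g where "adapted_frame p f g" using adapted_frame_exists by metis
    then interpret adapted_frame p f g .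
    have e: "apply2 (ext_deriv 1 eta) p X Y = - 2 * apply2 (omega3_tilde lam mu) p X Y"
      if "tangent X" "tangent Y" for X Y
      using E p that unfolding eq_forms_on_def apply2_def by simp
    obtain X where X: "tangent X" "P X = 0" "Q X = 0" "R X = 0" "S X = 1" "T X = 0"
      by (rule frame_vector)
    obtain Y where Y: "tangent Y" "P Y = 0" "Q Y = 0" "R Y = 0" "S Y = 0" "T Y = 1"
      by (rule frame_vector)
    have lam: "lam = - 1 / 2"
      using e[OF X(1) Y(1)] unfolding apply2_tilde deta_frame[OF X(1) Y(1)] vol_S2_frame
      by (simp add: X Y)
    obtain X where X: "tangent X" "P X = 1" "Q X = 0" "R X = 0" "S X = 0" "T X = 0"
      by (rule frame_vector)
    obtain Y where Y: "tangent Y" "P Y = 0" "Q Y = 1" "R Y = 0" "S Y = 0" "T Y = 0"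
      by (rule frame_vector)
    have "mu = 0"
      using e[OF X(1) Y(1)] unfolding apply2_tilde deta_frame[OF X(1) Y(1)] vol_S2_frame
      by (simp add: X Y)
    with lam show "lam = - 1 / 2 \<and> mu = 0" by simp
  next
    assume "lam = - 1 / 2 \<and> mu = 0"
    then show "eq_forms_on S2xS3 2 (ext_deriv 1 eta) (\<lambda>p v. - 2 * omega3_tilde lam mu p v)"
      by (simp add: eq_forms_on_def omega3_tilde_def)
  qed
  then show ?thesis
    unfolding sasaki_einstein_def using su2_structure_tilde[OF pos] d_omega12_tilde by simp
qed

theorem proposition6p3:
  shows "hypo S2xS3 eta omega1 omega2 omega3 \<and>
    (\<forall>lam mu :: real. lam < 0 \<and> mu > lam / 3 \<longrightarrow>
       hypo S2xS3 eta (omega1_tilde lam mu) (omega2_tilde lam mu) (omega3_tilde lam mu) \<and>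
       (double_hypo S2xS3 eta (omega1_tilde lam mu) (omega2_tilde lam mu) (omega3_tilde lam mu)
          \<longleftrightarrow> lam < - 1 / 4 \<and> mu = lam * (4 * lam + 2) / (3 * (4 * lam + 1))) \<and>
       (sasaki_einstein S2xS3 eta (omega1_tilde lam mu) (omega2_tilde lam mu) (omega3_tilde lam mu)
          \<longleftrightarrow> lam = - 1 / 2 \<and> mu = 0))"
proof (intro conjI allI impI; (elim conjE)?)
  \<comment> \<open>These parameters give \<open>3\<lambda>(\<lambda> - 3\<mu>) = 1\<close>.\<close>
  have "omega1 = omega1_tilde (- (1 / 3)) (2 / 9)" "omega2 = omega2_tilde (- (1 / 3)) (2 / 9)"
    "omega3 = omega3_tilde (- (1 / 3)) (2 / 9)"
    by (simp_all add: omega1_tilde_def omega2_tilde_def omega3_tilde_def omega3_def)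
  then show "hypo S2xS3 eta omega1 omega2 omega3"
    using hypo_tilde[of "- (1 / 3)" "2 / 9"] by simp
next
  fix lam mu :: real
  assume pos: "lam < 0" "mu > lam / 3"
  show "hypo S2xS3 eta (omega1_tilde lam mu) (omega2_tilde lam mu) (omega3_tilde lam mu)"
    by (rule hypo_tilde[OF pos])
  show "double_hypo S2xS3 eta (omega1_tilde lam mu) (omega2_tilde lam mu) (omega3_tilde lam mu)
      \<longleftrightarrow> lam < - 1 / 4 \<and> mu = lam * (4 * lam + 2) / (3 * (4 * lam + 1))"
    using hypo_tilde[OF pos] nearly_hypo_tilde_iff[OF pos] double_hypo_parameters[OF pos]
    unfolding double_hypo_def by blast
  show "sasaki_einstein S2xS3 eta (omega1_tilde lam mu) (omega2_tilde lam mu) (omega3_tilde lam mu)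
      \<longleftrightarrow> lam = - 1 / 2 \<and> mu = 0"
    by (rule sasaki_einstein_tilde_iff[OF pos])
qed

end
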